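(* Let $U$ be a special filtered algebra over $\Bbbk$, with associated graded algebra $\overline U=\operatorname{gr}U$. Let $g_1,\dots,g_t\in U$ be mutually commuting elements such that the sequence of their images $\overline g_1,\dots,\overline g_t$ is a complete intersection for $\overline U$, and let $\Gamma=\Bbbk[g_1,\dots,g_t]\subset U$ be the subalgebra generated by $g_1,\dots,g_t$. Then $U$ is free as a left $\Gamma$-module and free as a right $\Gamma$-module.
   Context: $\Bbbk$ is an algebraically closed field of characteristic $0$. An affine algebra is a finitely generated commutative associative $\Bbbk$-algebra. A filtered algebra is an associative (unital, not necessarily commutative) $\Bbbk$-algebra $U$ with an increasing filtration $\{U_i\}_{i\ge 0}$, $U_0=\Bbbk$, $U_iU_j\subset U_{i+j}$, $U=\bigcup_i U_i$ (put $U_{-1}=0$). Its associated graded algebra is $\overline U=\operatorname{gr}U=\bigoplus_{i\ge0}U_i/U_{i-1}$. If $u\in U_i\setminus U_{i-1}$, then $\deg u=i$ and $\overline u\in U_i/U_{i-1}$ is the class of $u$. Complete intersection sequence: for an associative algebra $R$ and a sequence $\mathsf g=\{g_1,\dots,g_t\}$ of mutually commuting elements of $R$, the Koszul complex $\mathbf K_\bullet(\mathsf g,R)$ is the complex of left $R$-modules with $\mathbf K_i=R\otimes_\Bbbk\bigwedge^i\Bbbk^t$ for $i\ge0$, $\mathbf K_i=0$ for $i<0$, and $d_i(a\otimes e_{j_1}\wedge\dots\wedge e_{j_i})=\sum_{k=1}^i(-1)^{k-1}ag_{j_k}\otimes e_{j_1}\wedge\dots\widehat{e_{j_k}}\dots\wedge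 e_{j_i}$. The sequence $\mathsf g$ is a complete intersection for $R$ if $H_i(\mathbf K_\bullet(\mathsf g,R))=0$ for $i\neq0$ and $H_0\ne0$ (here $H_0\simeq R/(Rg_1+\dots+Rg_t)$). A sequence $f_1,\dots,f_s$ in an affine algebra $\Lambda$ is regular if for each $i$ the class of $f_i$ in $\Lambda/(f_1,\dots,f_{i-1})$ is neither a zero divisor nor invertible. An affine algebra $\Lambda$ is a CI algebra if $\Lambda\simeq\Bbbk[X_1,\dots,X_n]/I$ for some $n$ and some ideal $I$ generated by a regular sequence. A filtered algebra $U$ is called special filtered if $\overline U$ is a reduced CI algebra (in particular commutative and affine). *)

theory Defs
  imports
    "HOL-Algebra.QuotRing"
    "HOL-Algebra.Module"
    "HOL-Algebra.Product_Groups"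
    "HOL-Library.Poly_Mapping"
    "HOL-Library.Set_Algebras"
    "HOL-Computational_Algebra.Polynomial"
begin

section \<open>Associative algebras over a field\<close>

text \<open>The algebra \<open>U\<close> is a type of class \<open>ring_1\<close> with a scalar multiplication. Algebras that
  are constructed as quotients (the associated graded algebra, polynomial rings modulo ideals) are
  HOL-Algebra records, with the field of scalars still given as a type.\<close>

locale assoc_algebra = vector_space scale
  for scale :: "'k::field \<Rightarrow> 'a::ring_1 \<Rightarrow> 'a" +
  assumes scale_mult_left: "scale c (x * y) = scale c x * y"
    and scale_mult_right: "scale c (x * y) = x * scale c y"
begin

definition subalgebra :: "'a set \<Rightarrow> bool" where
  "subalgebra S \<longleftrightarrow> subspace S \<and> 1 \<in> S \<and> (\<forall>x\<in>S. \<forall>y\<in>S. x * y \<in> S)"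

definition generated_subalgebra :: "'a set \<Rightarrow> 'a set" where
  "generated_subalgebra X = subalgebra hull X"

end

definition algebra_iso ::
  "('k, 'a) module \<Rightarrow> ('k, 'b) module \<Rightarrow> ('a \<Rightarrow> 'b) set" where
  "algebra_iso A B =
     {h \<in> ring_iso A B. \<forall>c. \<forall>x\<in>carrier A. h (c \<odot>\<^bsub>A\<^esub> x) = c \<odot>\<^bsub>B\<^esub> h x}"

definition quotient_algebra :: "('k, 'a) module \<Rightarrow> 'a set \<Rightarrow> ('k, 'a set) module" where
  "quotient_algebra A I = ring.extend (A Quot I)
     (module.fields (\<lambda>c X. \<Union>x\<in>X. I +>\<^bsub>A\<^esub> (c \<odot>\<^bsub>A\<^esub> x)))"

text \<open>\<open>\<Bbbk>[X\<^sub>0,\<dots>,X\<^sub>n\<^sub>-\<^sub>1]\<close>: a monomial is its finitely supported exponent function.\<close>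

definition polynomial_algebra ::
  "nat \<Rightarrow> ('k::field, (nat \<Rightarrow>\<^sub>0 nat) \<Rightarrow>\<^sub>0 'k) module" where
  "polynomial_algebra n =
    \<lparr> carrier = {p. \<forall>m\<in>Poly_Mapping.keys p. Poly_Mapping.keys m \<subseteq> {..<n}},
      monoid.mult = (*), monoid.one = 1, zero = 0, add = (+),
      module.smult = (\<lambda>c p. Poly_Mapping.single 0 c * p) \<rparr>"

section \<open>Complete intersection algebras\<close>

text \<open>Here \<open>genideal R (set (take i fs))\<close> is the ideal generated by the terms preceding \<open>fs ! i\<close>.
  The element \<open>0\<close> counts as a zero divisor of a nonzero ring.\<close>

definition regular_sequence :: "('a, 'm) ring_scheme \<Rightarrow> 'a list \<Rightarrow> bool" where
  "regular_sequence R fs \<longleftrightarrow> set fs \<subseteq> carrier R \<and>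
     (\<forall>i<length fs.
        let I = genideal R (set (take i fs)); Q = R Quot I; f = I +>\<^bsub>R\<^esub> (fs ! i)
        in (\<forall>y\<in>carrier Q. f \<otimes>\<^bsub>Q\<^esub> y = \<zero>\<^bsub>Q\<^esub> \<longrightarrow> y = \<zero>\<^bsub>Q\<^esub>) \<and> f \<notin> Units Q)"

definition CI_algebra :: "('k::field, 'a) module \<Rightarrow> bool" where
  "CI_algebra A \<longleftrightarrow>
     (\<exists>n fs. regular_sequence (polynomial_algebra n :: ('k, _) module) fs \<and>
        algebra_iso A
          (quotient_algebra (polynomial_algebra n) (genideal (polynomial_algebra n) (set fs)))
        \<noteq> {})"

definition reduced_ring :: "('a, 'm) ring_scheme \<Rightarrow> bool" where
  "reduced_ring R \<longleftrightarrow>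
     (\<forall>x\<in>carrier R. \<forall>n::nat. x [^]\<^bsub>R\<^esub> n = \<zero>\<^bsub>R\<^esub> \<longrightarrow> x = \<zero>\<^bsub>R\<^esub>)"

section \<open>The Koszul complex\<close>

text \<open>The basis vector \<open>e\<^bsub>j1\<^esub> \<and> \<dots> \<and> e\<^bsub>ji\<^esub>\<close> with \<open>j1 < \<dots> < ji\<close> of the exterior power is
  represented by the set of its indices (counted from \<open>0\<close>), and an element of
  \<open>R \<otimes> \<Lambda>\<^sup>i \<Bbbk>\<^sup>t\<close> by its family of coefficients in \<open>R\<close>. Degrees are integers, so that the
  chain groups in negative degrees are trivial.\<close>

definition wedge_basis :: "nat \<Rightarrow> int \<Rightarrow> nat set set" where
  "wedge_basis t i = {S. S \<subseteq> {..<t} \<and> int (card S) = i}"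

definition koszul_chains :: "('a, 'm) ring_scheme \<Rightarrow> nat \<Rightarrow> int \<Rightarrow> (nat set \<Rightarrow> 'a) monoid" where
  "koszul_chains R t i = product_group (wedge_basis t i) (\<lambda>_. add_monoid R)"

text \<open>The basis vector of \<open>T\<close> occurs in the differential of that of \<open>S\<close> iff \<open>S = insert k T\<close> with
  \<open>k \<notin> T\<close>; the position of \<open>k\<close> in \<open>S\<close>, counted from \<open>0\<close>, is the number of \<open>j \<in> T\<close> below
  \<open>k\<close>.\<close>

definition koszul_diff ::
  "('a, 'm) ring_scheme \<Rightarrow> 'a list \<Rightarrow> int \<Rightarrow> (nat set \<Rightarrow> 'a) \<Rightarrow> (nat set \<Rightarrow> 'a)" where
  "koszul_diff R g i \<phi> =
     (\<lambda>T \<in> wedge_basis (length g) (i - 1).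
        \<Oplus>\<^bsub>R\<^esub>k\<in>{..<length g} - T.
          (\<ominus>\<^bsub>R\<^esub> \<one>\<^bsub>R\<^esub>) [^]\<^bsub>R\<^esub> card {j\<in>T. j < k} \<otimes>\<^bsub>R\<^esub> (\<phi> (insert k T) \<otimes>\<^bsub>R\<^esub> g ! k))"

definition koszul_homology ::
  "('a, 'm) ring_scheme \<Rightarrow> 'a list \<Rightarrow> int \<Rightarrow> (nat set \<Rightarrow> 'a) set monoid" where
  "koszul_homology R g i =
     (let K = koszul_chains R (length g); d = koszul_diff R g
      in (K i)\<lparr>carrier := kernel (K i) (K (i - 1)) (d i)\<rparr> Mod (d (i + 1) ` carrier (K (i + 1))))"

definition complete_intersection :: "('a, 'm) ring_scheme \<Rightarrow> 'a list \<Rightarrow> bool" where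
  "complete_intersection R g \<longleftrightarrow> set g \<subseteq> carrier R \<and>
     (\<forall>x\<in>set g. \<forall>y\<in>set g. x \<otimes>\<^bsub>R\<^esub> y = y \<otimes>\<^bsub>R\<^esub> x) \<and>
     (\<forall>i. i \<noteq> 0 \<longrightarrow> trivial_group (koszul_homology R g i)) \<and>
     \<not> trivial_group (koszul_homology R g 0)"

section \<open>Filtered algebras and their associated graded algebras\<close>

locale filtered_algebra = assoc_algebra scale
  for scale :: "'k::field \<Rightarrow> 'a::ring_1 \<Rightarrow> 'a" +
  fixes F :: "nat \<Rightarrow> 'a set"
  assumes filt_subspace: "subspace (F i)"
    and filt_mono: "i \<le> j \<Longrightarrow> F i \<subseteq> F j"
    and filt_zero: "F 0 = range (\<lambda>c. scale c 1)"
    and filt_mult: "x \<in> F i \<Longrightarrow> y \<in> F j \<Longrightarrow> x * y \<in> F (i + j)"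
    and filt_exhaustive: "(\<Union>i. F i) = UNIV"

definition filt_pred :: "(nat \<Rightarrow> 'a::zero set) \<Rightarrow> nat \<Rightarrow> 'a set" where
  "filt_pred F i = (case i of 0 \<Rightarrow> {0} | Suc j \<Rightarrow> F j)"

definition gr_component :: "(nat \<Rightarrow> 'a::ring_1 set) \<Rightarrow> nat \<Rightarrow> 'a set set" where
  "gr_component F i = {u +o filt_pred F i | u. u \<in> F i}"

definition gr_component_mult ::
  "(nat \<Rightarrow> 'a::ring_1 set) \<Rightarrow> nat \<Rightarrow> nat \<Rightarrow> 'a set \<Rightarrow> 'a set \<Rightarrow> 'a set" where
  "gr_component_mult F i j X Y = (\<Union>u\<in>X. \<Union>v\<in>Y. (u * v) +o filt_pred F (i + j))"

text \<open>An element of the direct sum is a family of cosets \<open>x i \<in> U\<^sub>i / U\<^sub>i\<^sub>-\<^sub>1\<close>, almost all of which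
  are zero, that is, equal to \<open>filt_pred F i\<close>. Sums of cosets are sums of sets.\<close>

definition gr_algebra ::
  "('k::field \<Rightarrow> 'a::ring_1 \<Rightarrow> 'a) \<Rightarrow> (nat \<Rightarrow> 'a set) \<Rightarrow> ('k, nat \<Rightarrow> 'a set) module" where
  "gr_algebra scale F =
    \<lparr> carrier = {x. (\<forall>i. x i \<in> gr_component F i) \<and> finite {i. x i \<noteq> filt_pred F i}},
      monoid.mult = (\<lambda>x y n. \<Sum>i\<le>n. gr_component_mult F i (n - i) (x i) (y (n - i))),
      monoid.one = (\<lambda>i. if i = 0 then 1 +o filt_pred F 0 else filt_pred F i),
      zero = filt_pred F,
      add = (\<lambda>x y i. x i + y i),
      module.smult = (\<lambda>c x i. \<Union>u\<in>x i. scale c u +o filt_pred F i) \<rparr>"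

text \<open>For \<open>u \<noteq> 0\<close> the degree is the unique \<open>i\<close> with \<open>u \<in> U\<^sub>i - U\<^sub>i\<^sub>-\<^sub>1\<close>. The symbol of \<open>0\<close> comes out as
  the zero of the graded algebra.\<close>

definition filt_degree :: "(nat \<Rightarrow> 'a set) \<Rightarrow> 'a \<Rightarrow> nat" where
  "filt_degree F u = (LEAST i. u \<in> F i)"

definition gr_symbol :: "(nat \<Rightarrow> 'a::ring_1 set) \<Rightarrow> 'a \<Rightarrow> nat \<Rightarrow> 'a set" where
  "gr_symbol F u =
     (\<lambda>i. if i = filt_degree F u then u +o filt_pred F i else filt_pred F i)"

locale special_filtered_algebra = filtered_algebra scale F
  for scale :: "'k::field \<Rightarrow> 'a::ring_1 \<Rightarrow> 'a" and F +
  assumes gr_reduced: "reduced_ring (gr_algebra scale F)"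
    and gr_CI: "CI_algebra (gr_algebra scale F)"

section \<open>Freeness over a subring\<close>

definition left_basis :: "'a::ring_1 set \<Rightarrow> 'a set \<Rightarrow> bool" where
  "left_basis \<Gamma> B \<longleftrightarrow>
     (\<forall>u. \<exists>!c. (\<forall>b. c b \<in> \<Gamma>) \<and> (\<forall>b. b \<notin> B \<longrightarrow> c b = 0) \<and> finite {b. c b \<noteq> 0} \<and>
               u = (\<Sum>b | c b \<noteq> 0. c b * b))"

definition right_basis :: "'a::ring_1 set \<Rightarrow> 'a set \<Rightarrow> bool" where
  "right_basis \<Gamma> B \<longleftrightarrow>
     (\<forall>u. \<exists>!c. (\<forall>b. c b \<in> \<Gamma>) \<and> (\<forall>b. b \<notin> B \<longrightarrow> c b = 0) \<and> finite {b. c b \<noteq> 0} \<and>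
               u = (\<Sum>b | c b \<noteq> 0. b * c b))"

definition free_as_left_module :: "'a::ring_1 set \<Rightarrow> bool" where
  "free_as_left_module \<Gamma> \<longleftrightarrow> (\<exists>B. left_basis \<Gamma> B)"

definition free_as_right_module :: "'a::ring_1 set \<Rightarrow> bool" where
  "free_as_right_module \<Gamma> \<longleftrightarrow> (\<exists>B. right_basis \<Gamma> B)"

end

theory Submission
  imports Defs
begin

text \<open>Vanishing of the first Koszul homology of the symbols of the \<open>g j\<close> is read as a statement about
  the filtration of \<open>U\<close>: if \<open>\<Sum>j. a j * g j\<close> has smaller degree than expected then, up to terms of
  lower degree, \<open>a i = \<Sum>j. c i j * g j\<close> with \<open>c\<close> antisymmetric. Since the \<open>g j\<close> have positive degree
  (here \<open>H\<^sub>0 \<noteq> 0\<close> enters), a Nakayama argument passes this on to the initial segments of the sequence,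
  which makes the symbols a regular sequence. Now choose for every \<open>n\<close> a basis of a complement, in
  \<open>U\<^sub>n\<close>, of the elements whose class lies in the ideal generated by the symbols. The
  monomials in the \<open>g j\<close> times these basis vectors span \<open>U\<close> by induction on the degree, and they are
  independent by regularity. As the graded algebra is commutative, left and right multiplication by
  the \<open>g j\<close> agree modulo lower degree, so that both sides are instances of one statement about
  commuting operators on a filtered vector space.\<close>

section \<open>Commuting operators on a filtered vector space\<close>

text \<open>Koszul homology does not depend on the order of a sequence, whereas regularity in
  general does; strictly positive degrees are what lets exactness descend to initial segments, so
  \<open>d_pos\<close> belongs to the locale. All statements concern lifts in the filtered space,
  with equality modulo \<open>G (n - 1)\<close>, because spanning and independence are finally
  wanted in \<open>U\<close> itself; the graded algebra appears only where the hypotheses are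
  translated. In this form only the operators have to commute with each other, and no product of two
  arbitrary elements occurs. The filtration is indexed by integers, since degrees such as
  \<open>n - d i - d j\<close> may be negative; there \<open>G\<close> vanishes, which is also where
  the inductions on degree start.\<close>

locale filtered_operators = vector_space scale
  for scale :: "'k::field \<Rightarrow> 'a::ab_group_add \<Rightarrow> 'a" +
  fixes G :: "int \<Rightarrow> 'a set" and t :: nat and op :: "nat \<Rightarrow> 'a \<Rightarrow> 'a" and d :: "nat \<Rightarrow> int"
  assumes subspace_G: "subspace (G n)"
    and G_neg: "n < 0 \<Longrightarrow> G n = {0}"
    and G_mono: "m \<le> n \<Longrightarrow> G m \<subseteq> G n"
    and G_exhaustive: "\<exists>n. x \<in> G n"
    and op_add: "j < t \<Longrightarrow> op j (x + y) = op j x + op j y"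
    and op_scale: "j < t \<Longrightarrow> op j (scale c x) = scale c (op j x)"
    and op_G: "j < t \<Longrightarrow> x \<in> G n \<Longrightarrow> op j x \<in> G (n + d j)"
    and op_commute: "i < t \<Longrightarrow> j < t \<Longrightarrow> op i (op j x) = op j (op i x)"
    and d_pos: "j < t \<Longrightarrow> 0 < d j"
begin

lemma op_zero: "j < t \<Longrightarrow> op j 0 = 0"
  using op_scale[of j 0 0] by simp

lemma op_uminus: "j < t \<Longrightarrow> op j (- x) = - op j x"
  using op_add[of j x "- x"] op_zero[of j] by (simp add: eq_neg_iff_add_eq_0 add.commute)

lemma op_diff: "j < t \<Longrightarrow> op j (x - y) = op j x - op j y"
  using op_add[of j x "- y"] op_uminus[of j y] by simp

lemma op_sum: "j < t \<Longrightarrow> op j (\<Sum>i\<in>A. f i) = (\<Sum>i\<in>A. op j (f i))"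
  by (induction A rule: infinite_finite_induct) (auto simp: op_zero op_add)

lemmas G_zero = subspace_0[OF subspace_G]
  and G_add = subspace_add[OF subspace_G]
  and G_diff = subspace_diff[OF subspace_G]
  and G_uminus = subspace_neg[OF subspace_G]
  and G_sum = subspace_sum[OF subspace_G]

lemma op_G': "j < t \<Longrightarrow> x \<in> G (n - d j) \<Longrightarrow> op j x \<in> G n"
  using op_G[of j x "n - d j"] by simp

section \<open>Koszul cycles of the operators and the chains that bound them\<close>

text \<open>\<open>c\<close> is a chain of degree two whose boundary is \<open>a\<close>, both taken modulo lower degree. Thus
  \<open>koszul_exact s\<close> says that the first Koszul homology of the symbols of \<open>op 0, \<dots>, op (s - 1)\<close>
  vanishes.\<close>

definition bounds :: "nat \<Rightarrow> int \<Rightarrow> (nat \<Rightarrow> 'a) \<Rightarrow> (nat \<Rightarrow> nat \<Rightarrow> 'a) \<Rightarrow> bool" where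
  "bounds s n a c \<longleftrightarrow> (\<forall>i<s. c i i = 0) \<and>
     (\<forall>i<s. \<forall>j<s. c i j \<in> G (n - d i - d j)) \<and>
     (\<forall>i<s. \<forall>j<s. c i j + c j i = 0) \<and>
     (\<forall>i<s. a i - (\<Sum>j<s. op j (c i j)) \<in> G (n - d i - 1))"

definition koszul_exact :: "nat \<Rightarrow> bool" where
  "koszul_exact s \<longleftrightarrow> (\<forall>n a. (\<forall>j<s. a j \<in> G (n - d j)) \<longrightarrow>
     (\<Sum>j<s. op j (a j)) \<in> G (n - 1) \<longrightarrow> (\<exists>c. bounds s n a c))"

lemma boundsD:
  assumes "bounds s n a c"
  shows "\<And>i. i < s \<Longrightarrow> c i i = 0" "\<And>i j. i < s \<Longrightarrow> j < s \<Longrightarrow> c i j \<in> G (n - d i - d j)"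
    "\<And>i j. i < s \<Longrightarrow> j < s \<Longrightarrow> c i j + c j i = 0"
    "\<And>i. i < s \<Longrightarrow> a i - (\<Sum>j<s. op j (c i j)) \<in> G (n - d i - 1)"
  using assms unfolding bounds_def by simp_all

text \<open>A cycle for the first \<open>s\<close> operators is bounded by some \<open>c\<close> for \<open>s + 1\<close> operators; the row
  \<open>c s\<close> is then again a cycle for the first \<open>s\<close> operators, in smaller degree.\<close>

lemma koszul_exact_pred:
  assumes exact: "koszul_exact (Suc s)" and "s < t"
  shows "koszul_exact s"
proof -
  have "\<exists>c. bounds s n a c"
    if "\<forall>j<s. a j \<in> G (n - d j)" "(\<Sum>j<s. op j (a j)) \<in> G (n - 1)" for n a
    using that
  proof (induction "nat (n + 1)" arbitrary: n a rule: less_induct)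
    case less
    have lt: "j < s \<Longrightarrow> j < t" for j using \<open>s < t\<close> by simp
    show ?case
    proof (cases "n < 0")
      case True
      have "a i = 0" if "i < s" for i
        using less.prems(1) that True d_pos[OF lt[OF that]] G_neg[of "n - d i"] by auto
      then show ?thesis
        by (intro exI[of _ "\<lambda>i j. 0"]) (simp add: bounds_def G_zero op_zero lt)
    next
      case False
      \<comment> \<open>Extended by zero, a cycle for the first \<open>s\<close> operators is one
        for \<open>Suc s\<close> operators, to which the hypothesis applies.\<close>
      define a' where "a' = a(s := 0)"
      have sum_a': "(\<Sum>j<Suc s. op j (a' j)) = (\<Sum>j<s. op j (a j))"
        using \<open>s < t\<close> by (simp add: a'_def op_zero)
      have "a' j \<in> G (n - d j)" if "j < Suc s" for j
        using less.prems(1) that by (auto simp: a'_def G_zero less_Suc_eq)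
      then obtain c where "bounds (Suc s) n a' c"
        using exact less.prems(2) sum_a' unfolding koszul_exact_def by metis
      note c = boundsD[OF this]
      have "- (\<Sum>j<s. op j (c s j)) \<in> G (n - d s - 1)"
        using c(4)[of s] c(1)[of s] \<open>s < t\<close> by (simp add: a'_def op_zero)
      then have cyc: "(\<Sum>j<s. op j (c s j)) \<in> G (n - d s - 1)"
        using G_uminus by fastforce
      \<comment> \<open>The graded Nakayama argument: by exactness for \<open>Suc s\<close>
        operators, the symbol of \<open>op s\<close> maps the first homology of the shorter sequence
        onto itself, and it raises degrees. Positivity of \<open>d s\<close> turns this into an
        induction on \<open>n\<close>.\<close>
      have "nat (n - d s + 1) < nat (n + 1)"
        using d_pos[OF \<open>s < t\<close>] False by simp
      moreover have "\<forall>j<s. c s j \<in> G (n - d s - d j)"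
        using c(2) by simp
      ultimately obtain e where "bounds s (n - d s) (c s) e"
        using less.hyps[of "n - d s" "c s"] cyc by blast
      note e = boundsD[OF this]
      \<comment> \<open>The unwanted summand \<open>op s (c i s)\<close> equals
        \<open>- op s (c s i)\<close>. As \<open>e\<close> bounds \<open>c s\<close>, it is up to
        lower degree a combination of the \<open>op j (op s (e i j))\<close>, which is absorbed into
        \<open>c\<close>.\<close>
      define c' where "c' i j = c i j - op s (e i j)" for i j
      have 1: "c' i i = 0" if "i < s" for i
        using that \<open>s < t\<close> by (simp add: c'_def c(1) e(1) op_zero)
      have 2: "c' i j \<in> G (n - d i - d j)" if "i < s" "j < s" for i j
        unfolding c'_def using that e(2)[of i j] op_G[of s "e i j" "n - d s - d i - d j"] \<open>s < t\<close> c(2)[of i j]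
        by (intro G_diff) (auto simp: algebra_simps)
      have 3: "c' i j + c' j i = 0" if "i < s" "j < s" for i j
      proof -
        have "op s (e i j) + op s (e j i) = 0"
          using e(3)[OF that] op_add[OF \<open>s < t\<close>] op_zero[OF \<open>s < t\<close>] by metis
        then show ?thesis
          using c(3)[of i j] that unfolding c'_def
          by (metis add_diff_add diff_zero less_Suc_eq)
      qed
      have 4: "a i - (\<Sum>j<s. op j (c' i j)) \<in> G (n - d i - 1)" if "i < s" for i
      proof -
        have row_i: "op s (c s i - (\<Sum>j<s. op j (e i j))) \<in> G (n - d i - 1)"
          using op_G[OF \<open>s < t\<close> e(4)[OF that]] by (simp add: algebra_simps)
        have cycle_i: "a i - (\<Sum>j<s. op j (c i j)) - op s (c i s) \<in> G (n - d i - 1)"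
          using c(4)[of i] that by (simp add: a'_def algebra_simps)
        have "op s (c i s) = - op s (c s i)"
        proof -
          have "c i s = - c s i"
            using c(3)[of i s] that by (simp add: eq_neg_iff_add_eq_0)
          then show ?thesis
            using op_uminus[OF \<open>s < t\<close>] by simp
        qed
        moreover have "op s (\<Sum>j<s. op j (e i j)) = (\<Sum>j<s. op j (op s (e i j)))"
          unfolding op_sum[OF \<open>s < t\<close>] using \<open>s < t\<close> by (intro sum.cong) (simp_all add: op_commute[OF \<open>s < t\<close> lt])
        moreover have "(\<Sum>j<s. op j (c' i j)) = (\<Sum>j<s. op j (c i j)) - (\<Sum>j<s. op j (op s (e i j)))"
          by (simp add: c'_def op_diff lt sum_subtractf)
        ultimately have "a i - (\<Sum>j<s. op j (c' i j)) = a i - (\<Sum>j<s. op j (c i j)) - op s (c i s)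
            - op s (c s i - (\<Sum>j<s. op j (e i j)))"
          by (simp add: op_diff[OF \<open>s < t\<close>])
        then show ?thesis
          using G_diff[OF cycle_i row_i] by (rule ssubst)
      qed
      show ?thesis
        using 1 2 3 4 unfolding bounds_def by blast
    qed
  qed
  then show ?thesis unfolding koszul_exact_def by blast
qed

lemma koszul_exact_le:
  assumes "koszul_exact t" "s \<le> t"
  shows "koszul_exact s"
  using assms(2,1)
  by (induction rule: inc_induct) (auto intro: koszul_exact_pred)

section \<open>The ideal of the symbols and regularity\<close>

text \<open>The part of \<open>G n\<close> whose class in \<open>G n / G (n - 1)\<close> lies in the ideal generated by the symbols
  of the first \<open>s\<close> operators.\<close>

definition J :: "nat \<Rightarrow> int \<Rightarrow> 'a set" where
  "J s n = {x. \<exists>w. (\<forall>j<s. w j \<in> G (n - d j)) \<and> x - (\<Sum>j<s. op j (w j)) \<in> G (n - 1)}"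

lemma subspace_J:
  assumes "s \<le> t"
  shows "subspace (J s n)"
proof (rule subspaceI)
  have lt: "j < s \<Longrightarrow> j < t" for j using assms by simp
  show "0 \<in> J s n"
    unfolding J_def by (auto intro!: exI[of _ "\<lambda>_. 0"] simp: G_zero op_zero lt)
  show "x + y \<in> J s n" if xy: "x \<in> J s n" "y \<in> J s n" for x y
  proof -
    obtain v where v: "\<forall>j<s. v j \<in> G (n - d j)" "x - (\<Sum>j<s. op j (v j)) \<in> G (n - 1)"
      using xy(1) unfolding J_def by blast
    obtain w where w: "\<forall>j<s. w j \<in> G (n - d j)" "y - (\<Sum>j<s. op j (w j)) \<in> G (n - 1)"
      using xy(2) unfolding J_def by blast
    have "x + y - (\<Sum>j<s. op j (v j + w j)) =
        (x - (\<Sum>j<s. op j (v j))) + (y - (\<Sum>j<s. op j (w j)))"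
      by (simp add: op_add lt sum.distrib)
    then have "x + y - (\<Sum>j<s. op j (v j + w j)) \<in> G (n - 1)"
      using G_add[OF v(2) w(2)] by (rule ssubst)
    moreover have "\<forall>j<s. v j + w j \<in> G (n - d j)"
      using v(1) w(1) G_add by blast
    ultimately show ?thesis
      unfolding J_def by (intro CollectI exI[of _ "\<lambda>j. v j + w j"] conjI)
  qed
  show "scale c x \<in> J s n" if x: "x \<in> J s n" for c x
  proof -
    obtain v where "\<forall>j<s. v j \<in> G (n - d j)" "x - (\<Sum>j<s. op j (v j)) \<in> G (n - 1)"
      using x unfolding J_def by blast
    moreover have "scale c x - (\<Sum>j<s. op j (scale c (v j))) = scale c (x - (\<Sum>j<s. op j (v j)))"
      by (simp add: op_scale lt scale_right_diff_distrib scale_sum_right)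
    ultimately show ?thesis
      unfolding J_def using subspace_scale[OF subspace_G]
      by (auto intro!: exI[of _ "\<lambda>j. scale c (v j)"])
  qed
qed

lemma J_subset_G:
  assumes "s \<le> t"
  shows "J s n \<subseteq> G n"
proof
  fix x assume "x \<in> J s n"
  then obtain w where w: "\<forall>j<s. w j \<in> G (n - d j)" "x - (\<Sum>j<s. op j (w j)) \<in> G (n - 1)"
    unfolding J_def by blast
  have "(\<Sum>j<s. op j (w j)) \<in> G n"
    using w(1) assms by (intro G_sum op_G') auto
  then show "x \<in> G n"
    using G_add[of "x - (\<Sum>j<s. op j (w j))" n] w(2) G_mono[of "n - 1" n] by fastforce
qed

lemma J_Suc_diff:
  assumes "s < t" "x \<in> J s n" "y \<in> G (n - d s)"
  shows "x - op s y \<in> J (Suc s) n"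
proof -
  obtain w where "\<forall>j<s. w j \<in> G (n - d j)" "x - (\<Sum>j<s. op j (w j)) \<in> G (n - 1)"
    using assms(2) unfolding J_def by blast
  then show ?thesis
    unfolding J_def using assms
    by (intro CollectI exI[of _ "w(s := - y)"]) (auto simp: less_Suc_eq op_uminus G_uminus)
qed

text \<open>A relation \<open>op s y = (\<Sum>j<s. op j (w j))\<close> modulo lower degree is a
  Koszul cycle with entry \<open>y\<close> at \<open>s\<close>. The row \<open>c s\<close> of a
  bounding chain, whose diagonal entry is zero, writes \<open>y\<close> in terms of the first
  \<open>s\<close> operators alone. This is the non-zero-divisor property of the symbol of
  \<open>op s\<close>.\<close>

lemma regular_mod_J:
  assumes exact: "koszul_exact (Suc s)" and "s < t" "y \<in> G (n - d s)" "op s y \<in> J s n"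
  shows "y \<in> J s (n - d s)"
proof -
  have lt: "j < s \<Longrightarrow> j < t" for j using \<open>s < t\<close> by simp
  obtain w where w: "\<forall>j<s. w j \<in> G (n - d j)" "op s y - (\<Sum>j<s. op j (w j)) \<in> G (n - 1)"
    using assms(4) unfolding J_def by blast
  define a where "a j = (if j = s then y else - w j)" for j
  have "(\<Sum>j<Suc s. op j (a j)) = op s y - (\<Sum>j<s. op j (w j))"
    by (simp add: a_def op_uminus lt sum_negf)
  moreover have "a j \<in> G (n - d j)" if "j < Suc s" for j
    using w(1) assms(3) that by (auto simp: a_def G_uminus less_Suc_eq)
  ultimately obtain c where "bounds (Suc s) n a c"
    using exact w(2) unfolding koszul_exact_def by metis
  note c = boundsD[OF this]
  have "y - (\<Sum>j<s. op j (c s j)) \<in> G (n - d s - 1)"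
    using c(4)[of s] c(1)[of s] \<open>s < t\<close> by (simp add: a_def op_zero)
  moreover have "\<forall>j<s. c s j \<in> G (n - d s - d j)"
    using c(2) by simp
  ultimately show ?thesis
    unfolding J_def by blast
qed

section \<open>Monomials in the operators\<close>

text \<open>Starting at \<open>s\<close> lets a descending induction add one operator at a time.
  Exponents outside the range have no effect, which is why they are required to be zero wherever
  distinct exponents must mean distinct monomials.\<close>

definition mon :: "nat \<Rightarrow> (nat \<Rightarrow> nat) \<Rightarrow> 'a \<Rightarrow> 'a" where
  "mon s \<alpha> = foldr (\<lambda>j. op j ^^ \<alpha> j) [s..<t]"

definition wt :: "nat \<Rightarrow> (nat \<Rightarrow> nat) \<Rightarrow> int" where
  "wt s \<alpha> = (\<Sum>j=s..<t. int (\<alpha> j) * d j)"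

lemma mon_top: "mon t \<alpha> x = x"
  by (simp add: mon_def)

lemma mon_rec: "s < t \<Longrightarrow> mon s \<alpha> x = (op s ^^ \<alpha> s) (mon (Suc s) \<alpha> x)"
  by (simp add: mon_def upt_conv_Cons)

lemma wt_rec: "s < t \<Longrightarrow> wt s \<alpha> = int (\<alpha> s) * d s + wt (Suc s) \<alpha>"
  by (simp add: wt_def sum.atLeast_Suc_lessThan)

lemma mon_cong: "(\<And>j. s \<le> j \<Longrightarrow> j < t \<Longrightarrow> \<alpha> j = \<beta> j) \<Longrightarrow> mon s \<alpha> = mon s \<beta>"
  unfolding mon_def by (intro ext foldr_cong) auto

lemma wt_cong: "(\<And>j. s \<le> j \<Longrightarrow> j < t \<Longrightarrow> \<alpha> j = \<beta> j) \<Longrightarrow> wt s \<alpha> = wt s \<beta>"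
  unfolding wt_def by (intro sum.cong) auto

lemma mon_upd: "s < t \<Longrightarrow> mon s (\<alpha>(s := Suc (\<alpha> s))) x = op s (mon s \<alpha> x)"
  using mon_cong[of "Suc s" "\<alpha>(s := Suc (\<alpha> s))" \<alpha>] by (simp add: mon_rec)

lemma wt_upd: "s < t \<Longrightarrow> wt s (\<alpha>(s := Suc (\<alpha> s))) = wt s \<alpha> + d s"
  using wt_cong[of "Suc s" "\<alpha>(s := Suc (\<alpha> s))" \<alpha>] by (simp add: wt_rec algebra_simps)

lemma funpow_op_commute:
  "i < t \<Longrightarrow> j < t \<Longrightarrow> op i ((op j ^^ k) x) = (op j ^^ k) (op i x)"
  by (induction k) (simp_all add: op_commute[of i j])

text \<open>\<open>op j\<close> moves inwards past the powers of the operators of smaller index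
  until it meets its own power.\<close>

lemma op_mon:
  assumes "s \<le> j" "j < t"
  shows "op j (mon s \<alpha> x) = mon s (\<alpha>(j := Suc (\<alpha> j))) x"
  using assms
proof (induction rule: inc_induct)
  case base
  then show ?case by (simp only: mon_upd)
next
  case (step s)
  then show ?case by (simp add: mon_rec funpow_op_commute)
qed

lemma funpow_op_linear:
  assumes "s < t"
  shows "(op s ^^ k) (x + y) = (op s ^^ k) x + (op s ^^ k) y"
    "(op s ^^ k) (scale c x) = scale c ((op s ^^ k) x)"
  by (induction k) (auto simp: op_add op_scale assms)

lemma mon_linear:
  assumes "s \<le> t"
  shows "mon s \<alpha> (x + y) = mon s \<alpha> x + mon s \<alpha> y" "mon s \<alpha> (scale c x) = scale c (mon s \<alpha> x)"
proof -
  have "mon s \<alpha> (x + y) = mon s \<alpha> x + mon s \<alpha> y \<and> mon s \<alpha> (scale c x) = scale c (mon s \<alpha> x)"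
    using assms by (induction rule: inc_induct) (auto simp: mon_top mon_rec funpow_op_linear)
  then show "mon s \<alpha> (x + y) = mon s \<alpha> x + mon s \<alpha> y" "mon s \<alpha> (scale c x) = scale c (mon s \<alpha> x)"
    by auto
qed

lemma mon_sum:
  assumes "s \<le> t"
  shows "mon s \<alpha> (\<Sum>i\<in>A. f i) = (\<Sum>i\<in>A. mon s \<alpha> (f i))"
proof -
  have "mon s \<alpha> 0 = 0"
    using mon_linear(2)[OF assms, of \<alpha> 0 0] by simp
  then show ?thesis
    by (induction A rule: infinite_finite_induct) (auto simp: mon_linear[OF assms])
qed

lemma funpow_op_G: "s < t \<Longrightarrow> x \<in> G n \<Longrightarrow> (op s ^^ k) x \<in> G (n + int k * d s)"
proof (induction k)
  case (Suc k)
  then show ?case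
    using op_G[of s "(op s ^^ k) x" "n + int k * d s"] by (simp add: algebra_simps)
qed simp

lemma mon_G:
  assumes "s \<le> t" "x \<in> G n"
  shows "mon s \<alpha> x \<in> G (n + wt s \<alpha>)"
  using assms
proof (induction rule: inc_induct)
  case base
  then show ?case by (simp add: mon_top wt_def)
next
  case (step s)
  then show ?case
    using funpow_op_G[of s "mon (Suc s) \<alpha> x" "n + wt (Suc s) \<alpha>" "\<alpha> s"]
    by (simp add: mon_rec wt_rec algebra_simps)
qed

section \<open>Complements of the ideal and the monomial basis\<close>

text \<open>A basis \<open>C\<close> of \<open>J s n\<close> extends to a basis \<open>D\<close> of
  \<open>G n\<close>, and the added vectors span a complement.\<close>

lemma complement_basis:
  assumes "s \<le> t"
  obtains B where "B \<subseteq> G n" "independent B" "span B \<inter> J s n = {0}"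
    "\<And>x. x \<in> G n \<Longrightarrow> \<exists>v\<in>span B. x - v \<in> J s n"
proof -
  obtain C where C: "C \<subseteq> J s n" "independent C" "J s n \<subseteq> span C"
    using maximal_independent_subset by blast
  obtain D where D: "C \<subseteq> D" "D \<subseteq> G n" "independent D" "G n \<subseteq> span D"
    using maximal_independent_subset_extend[of C "G n"] C(1,2) J_subset_G[OF assms, of n] by blast
  have spanC: "span C = J s n"
    using C span_minimal[OF C(1) subspace_J[OF assms]] by blast
  \<comment> \<open>Both representations of \<open>x\<close> agree with the one over
    \<open>D\<close>, but their supports are disjoint.\<close>
  have "x = 0" if x: "x \<in> span (D - C)" "x \<in> span C" for x
  proof (rule ccontr)
    assume "x \<noteq> 0"
    have indep: "independent (D - C)" "independent C"
      using D(3) C(2) independent_mono[of D "D - C"] by auto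
    have "representation (D - C) x = representation D x" "representation C x = representation D x"
      using representation_extend[OF D(3)] x D(1) by (metis Diff_subset)+
    then have eq: "representation (D - C) x = representation C x" by simp
    obtain b where "representation C x b \<noteq> 0"
      using sum_nonzero_representation_eq[OF indep(2) x(2)] \<open>x \<noteq> 0\<close>
      by (metis (mono_tags, lifting) scale_zero_left sum.neutral)
    then show False
      using representation_ne_zero[of C x b] representation_ne_zero[of "D - C" x b] eq by auto
  qed
  then have "span (D - C) \<inter> J s n = {0}"
    using spanC span_zero[of "D - C"] subspace_0[OF subspace_J[OF assms]] by blast
  moreover have "\<exists>v\<in>span (D - C). x - v \<in> J s n" if "x \<in> G n" for x
  proof -
    have "x \<in> span ((D - C) \<union> C)"
      using that D(1,4) by (metis Diff_partition Un_commute subsetD)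
    then obtain v w where "x = v + w" "v \<in> span (D - C)" "w \<in> span C"
      unfolding span_Un by blast
    then show ?thesis
      using spanC by (intro bexI[of _ v]) auto
  qed
  ultimately show ?thesis
    using that[of "D - C"] D(2,3) independent_mono[of D "D - C"] by blast
qed

text \<open>If each \<open>V n\<close> meets \<open>J t n\<close> trivially then the monomials in \<open>op s, \<dots>, op (t - 1)\<close> are
  independent over the \<open>V n\<close> modulo \<open>J s n\<close>: descending induction on \<open>s\<close>, where modulo
  \<open>J (Suc s) n\<close> only the monomials without \<open>op s\<close> survive and regularity allows to cancel
  \<open>op s\<close> from the others.\<close>

lemma mon_independent_mod:
  assumes exact: "koszul_exact t"
    and V: "\<And>n. V n \<subseteq> G n" "\<And>n. V n \<inter> J t n = {0}"
    and "s \<le> t"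
    and "finite M" "\<And>\<alpha> j. \<alpha> \<in> M \<Longrightarrow> j < s \<or> t \<le> j \<Longrightarrow> \<alpha> j = 0"
    and "\<And>\<alpha>. \<alpha> \<in> M \<Longrightarrow> v \<alpha> \<in> V (n - wt s \<alpha>)"
    and "(\<Sum>\<alpha>\<in>M. mon s \<alpha> (v \<alpha>)) \<in> J s n"
  shows "\<forall>\<alpha>\<in>M. v \<alpha> = 0"
  using assms(4-)
proof (induction arbitrary: M v n rule: inc_induct)
  case base
  \<comment> \<open>At \<open>s = t\<close> no operator is left, and the exponent, being zero
    outside the range of \<open>mon\<close>, is zero everywhere.\<close>
  have "\<alpha> = (\<lambda>_. 0)" if "\<alpha> \<in> M" for \<alpha>
    using base(2)[OF that] by (meson ext linorder_not_le)
  then have M: "M \<subseteq> {\<lambda>_. 0}" by blast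
  show ?case
  proof
    fix \<alpha> assume "\<alpha> \<in> M"
    then have "M = {\<lambda>_. 0}" "\<alpha> = (\<lambda>_. 0)" using M by blast+
    then show "v \<alpha> = 0"
      using base(3,4) V(2)[of n] by (auto simp: mon_top wt_def)
  qed
next
  case (step s)
  \<comment> \<open>An inner induction on a strict bound \<open>m\<close> for the exponents at
    \<open>s\<close>. Cancelling \<open>op s\<close> lowers the degree by \<open>d s\<close>, so
    \<open>n\<close> has to stay arbitrary.\<close>
  have "\<forall>\<alpha>\<in>M. v \<alpha> = 0"
    if "\<forall>\<alpha>\<in>M. \<alpha> s < m" "finite M" "\<And>\<alpha> j. \<alpha> \<in> M \<Longrightarrow> j < s \<or> t \<le> j \<Longrightarrow> \<alpha> j = 0"
      "\<And>\<alpha>. \<alpha> \<in> M \<Longrightarrow> v \<alpha> \<in> V (n - wt s \<alpha>)" "(\<Sum>\<alpha>\<in>M. mon s \<alpha> (v \<alpha>)) \<in> J s n" for m M v n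
    using that
  proof (induction m arbitrary: M v n)
    case 0
    then show ?case by auto
  next
    case (Suc m)
    note s = \<open>s < t\<close>
    define M0 where "M0 = {\<alpha>\<in>M. \<alpha> s = 0}"
    \<comment> \<open>The exponents with a positive entry at \<open>s\<close>, lowered by one there;
      raising them again gives the part of \<open>M\<close> outside \<open>M0\<close>.\<close>
    define N where "N = {\<alpha>. \<alpha>(s := Suc (\<alpha> s)) \<in> M}"
    let ?up = "\<lambda>\<alpha>. \<alpha>(s := Suc (\<alpha> s))"
    have inj: "inj ?up"
    proof (rule injI)
      fix x y :: "nat \<Rightarrow> nat" assume eq: "?up x = ?up y"
      show "x = y"
      proof
        fix i show "x i = y i"
          using fun_cong[OF eq, of i] by (cases "i = s") auto
      qed
    qed
    have M: "M = M0 \<union> ?up ` N"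
    proof (intro equalityI subsetI)
      fix \<alpha> assume \<alpha>: "\<alpha> \<in> M"
      show "\<alpha> \<in> M0 \<union> ?up ` N"
      proof (cases "\<alpha> s")
        case 0
        then show ?thesis using \<alpha> by (simp add: M0_def)
      next
        case (Suc k)
        then have "\<alpha> = ?up (\<alpha>(s := k))" by auto
        then show ?thesis using \<alpha> unfolding N_def by (metis (no_types, lifting) UnCI image_eqI mem_Collect_eq)
      qed
    qed (auto simp: M0_def N_def)
    have fin: "finite M0" "finite N"
      using Suc.prems(2) M finite_imageD[of ?up N] inj
      by (auto simp: inj_on_def)
    define y where "y = (\<Sum>\<alpha>\<in>N. mon s \<alpha> (v (?up \<alpha>)))"
    have vN: "v (?up \<alpha>) \<in> V (n - d s - wt s \<alpha>)" if "\<alpha> \<in> N" for \<alpha>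
    proof -
      have "n - wt s (?up \<alpha>) = n - d s - wt s \<alpha>"
        using wt_upd[OF s] by simp
      then show ?thesis
        using that Suc.prems(4)[of "?up \<alpha>"] unfolding N_def by (metis mem_Collect_eq)
    qed
    have "M0 \<inter> ?up ` N = {}"
      by (auto simp: M0_def)
    then have "(\<Sum>\<alpha>\<in>M. mon s \<alpha> (v \<alpha>)) =
        (\<Sum>\<alpha>\<in>M0. mon s \<alpha> (v \<alpha>)) + (\<Sum>\<alpha>\<in>?up ` N. mon s \<alpha> (v \<alpha>))"
      using fin by (simp add: M sum.union_disjoint)
    also have "(\<Sum>\<alpha>\<in>?up ` N. mon s \<alpha> (v \<alpha>)) = op s y"
      unfolding y_def op_sum[OF s] using inj s
      by (subst sum.reindex) (auto intro: inj_on_subset simp: mon_upd)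
    also have "(\<Sum>\<alpha>\<in>M0. mon s \<alpha> (v \<alpha>)) = (\<Sum>\<alpha>\<in>M0. mon (Suc s) \<alpha> (v \<alpha>))"
      using s by (intro sum.cong) (auto simp: M0_def mon_rec)
    finally have split: "(\<Sum>\<alpha>\<in>M. mon s \<alpha> (v \<alpha>)) = (\<Sum>\<alpha>\<in>M0. mon (Suc s) \<alpha> (v \<alpha>)) + op s y" .
    have y: "y \<in> G (n - d s)"
      unfolding y_def
    proof (rule G_sum)
      fix \<alpha> assume "\<alpha> \<in> N"
      then show "mon s \<alpha> (v (?up \<alpha>)) \<in> G (n - d s)"
        using mon_G[of s "v (?up \<alpha>)" "n - d s - wt s \<alpha>" \<alpha>] vN[of \<alpha>] V(1) s by fastforce
    qed
    \<comment> \<open>Modulo \<open>J (Suc s) n\<close> the summand \<open>op s y\<close> vanishes,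
      so the outer induction disposes of the monomials without \<open>op s\<close>.\<close>
    have "\<forall>\<alpha>\<in>M0. v \<alpha> = 0"
    proof (rule step.IH)
      show "finite M0" by (rule fin)
      show "\<alpha> j = 0" if "\<alpha> \<in> M0" "j < Suc s \<or> t \<le> j" for \<alpha> j
        using that Suc.prems(3) by (auto simp: M0_def less_Suc_eq)
      show "v \<alpha> \<in> V (n - wt (Suc s) \<alpha>)" if "\<alpha> \<in> M0" for \<alpha>
        using that Suc.prems(4)[of \<alpha>] s by (simp add: M0_def wt_rec)
      show "(\<Sum>\<alpha>\<in>M0. mon (Suc s) \<alpha> (v \<alpha>)) \<in> J (Suc s) n"
        using J_Suc_diff[OF s Suc.prems(5) y] by (simp add: split)
    qed
    moreover have "\<forall>\<alpha>\<in>N. v (?up \<alpha>) = 0"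
    proof (rule Suc.IH)
      show "\<forall>\<alpha>\<in>N. \<alpha> s < m"
        using Suc.prems(1) by (auto simp: N_def)
      show "finite N" by (rule fin)
      show "\<alpha> j = 0" if "\<alpha> \<in> N" "j < s \<or> t \<le> j" for \<alpha> j
      proof -
        have "?up \<alpha> j = 0"
          using that Suc.prems(3) unfolding N_def by blast
        then show ?thesis by (simp split: if_splits)
      qed
      show "v (?up \<alpha>) \<in> V (n - d s - wt s \<alpha>)" if "\<alpha> \<in> N" for \<alpha>
        by (rule vN[OF that])
      \<comment> \<open>What remains of the sum is \<open>op s y\<close>, and regularity allows the
        cancellation.\<close>
      have "(\<Sum>\<alpha>\<in>M0. mon (Suc s) \<alpha> (v \<alpha>)) = 0"
        using calculation mon_linear(2)[of "Suc s" _ 0 0] s by (intro sum.neutral) auto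
      then have "op s y \<in> J s n"
        using Suc.prems(5) split by simp
      then show "(\<Sum>\<alpha>\<in>N. mon s \<alpha> (v (?up \<alpha>))) \<in> J s (n - d s)"
        using regular_mod_J[OF koszul_exact_le[OF exact] s y] s by (simp add: y_def)
    qed
    ultimately show ?case
      unfolding M by blast
  qed
  moreover have "\<forall>\<alpha>\<in>M. \<alpha> s < Suc (Max ((\<lambda>\<alpha>. \<alpha> s) ` M))"
    using step.prems(1) by (simp add: less_Suc_eq_le)
  ultimately show ?case
    using step.prems by blast
qed

text \<open>Spanning is stated as an induction principle, to be applied with \<open>S\<close> the
  set of elements that possess an expansion. For independence, the terms of maximal weight
  \<open>n\<close> in a relation add up to an element of \<open>G (n - 1)\<close>, which is
  \<open>J 0 n\<close>, so that the independence modulo \<open>J 0 n\<close> applies to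
  them.\<close>

theorem monomial_basis:
  assumes exact: "koszul_exact t"
  obtains B where
    "\<And>S. subspace S \<Longrightarrow> B \<subseteq> S \<Longrightarrow> (\<And>j x. j < t \<Longrightarrow> x \<in> S \<Longrightarrow> op j x \<in> S) \<Longrightarrow> S = UNIV"
    "\<And>M cf p. finite M \<Longrightarrow> (\<And>\<alpha> b. (\<alpha>, b) \<in> M \<Longrightarrow> b \<in> B \<and> (\<forall>j\<ge>t. \<alpha> j = 0)) \<Longrightarrow>
       (\<Sum>(\<alpha>, b)\<in>M. scale (cf (\<alpha>, b)) (mon 0 \<alpha> b)) = 0 \<Longrightarrow> p \<in> M \<Longrightarrow> cf p = 0"
proof -
  have "\<exists>B. B \<subseteq> G n \<and> independent B \<and> span B \<inter> J t n = {0} \<and>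
    (\<forall>x\<in>G n. \<exists>v\<in>span B. x - v \<in> J t n)" for n
    using complement_basis[of t n] by (metis order_refl)
  then obtain B where B: "\<And>n. B n \<subseteq> G n" "\<And>n. independent (B n)" "\<And>n. span (B n) \<inter> J t n = {0}"
    "\<And>n x. x \<in> G n \<Longrightarrow> \<exists>v\<in>span (B n). x - v \<in> J t n"
    by metis
  have 1: "S = UNIV"
    if S: "subspace S" "(\<Union>n. B n) \<subseteq> S" "\<And>j x. j < t \<Longrightarrow> x \<in> S \<Longrightarrow> op j x \<in> S" for S
  proof -
    have "x \<in> S" if "x \<in> G n" for n x
      using that
    proof (induction "nat (n + 1)" arbitrary: n x rule: less_induct)
      case less
      show ?case
      proof (cases "n < 0")
        case True
        then show ?thesis using less.prems G_neg subspace_0[OF S(1)] by auto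
      next
        case False
        obtain v where v: "v \<in> span (B n)" "x - v \<in> J t n"
          using B(4)[OF less.prems] by blast
        then obtain w where w: "\<And>j. j < t \<Longrightarrow> w j \<in> G (n - d j)"
            "x - v - (\<Sum>j<t. op j (w j)) \<in> G (n - 1)"
          unfolding J_def by blast
        have "v \<in> S"
          using v(1) S(1,2) span_minimal[of "B n" S] by blast
        moreover have "(\<Sum>j<t. op j (w j)) \<in> S"
        proof (intro subspace_sum[OF S(1)] S(3))
          fix j assume "j \<in> {..<t}"
          then show "w j \<in> S"
            using w(1) d_pos[of j] False by (intro less.hyps[of "n - d j"]) auto
        qed auto
        moreover have "x - v - (\<Sum>j<t. op j (w j)) \<in> S"
          using w(2) False by (intro less.hyps[of "n - 1"]) auto
        moreover have "x = v + (\<Sum>j<t. op j (w j)) + (x - v - (\<Sum>j<t. op j (w j)))"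
          by simp
        ultimately show ?thesis
          using subspace_add[OF S(1)] by metis
      qed
    qed
    then show ?thesis using G_exhaustive by blast
  qed
  have 2: "cf p = 0"
    if M: "finite M" "\<And>\<alpha> b. (\<alpha>, b) \<in> M \<Longrightarrow> b \<in> (\<Union>n. B n) \<and> (\<forall>j\<ge>t. \<alpha> j = 0)"
      "(\<Sum>(\<alpha>, b)\<in>M. scale (cf (\<alpha>, b)) (mon 0 \<alpha> b)) = 0" and "p \<in> M" for M cf p
  proof (rule ccontr)
    assume "cf p \<noteq> 0"
    \<comment> \<open>Some \<open>n\<close> with \<open>b \<in> B n\<close>; this membership is all
      that the weights rely on.\<close>
    define deg where "deg b = (SOME n. b \<in> B n)" for b
    have deg: "b \<in> B (deg b)" if "(\<alpha>, b) \<in> M" for \<alpha> b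
      unfolding deg_def using M(2)[OF that] by (intro someI_ex[of "\<lambda>n. b \<in> B n"]) blast
    define w where "w = (\<lambda>(\<alpha>, b). wt 0 \<alpha> + deg b)"
    define M' where "M' = {q\<in>M. cf q \<noteq> 0}"
    have M': "finite M'" "p \<in> M'" using M(1) \<open>p \<in> M\<close> \<open>cf p \<noteq> 0\<close> by (auto simp: M'_def)
    define n where "n = Max (w ` M')"
    have "n \<in> w ` M'" unfolding n_def using M' by (intro Max_in) auto
    then obtain \<alpha>0 b0 where p0: "(\<alpha>0, b0) \<in> M'" "w (\<alpha>0, b0) = n" by force
    have le: "w q \<le> n" if "q \<in> M'" for q
      unfolding n_def using M' that by simp
    define M1 where "M1 = {q\<in>M'. w q = n}"
    let ?f = "\<lambda>(\<alpha>, b). scale (cf (\<alpha>, b)) (mon 0 \<alpha> b)"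
    have "sum ?f M' = sum ?f M"
      using M(1) by (intro sum.mono_neutral_left) (auto simp: M'_def)
    then have "sum ?f M1 + sum ?f (M' - M1) = 0"
      using M(3) M' by (simp add: M1_def sum.subset_diff[of "{q\<in>M'. w q = n}" M'] add.commute)
    moreover have "sum ?f (M' - M1) \<in> G (n - 1)"
    proof (intro G_sum)
      fix q assume q: "q \<in> M' - M1"
      obtain \<alpha> b where [simp]: "q = (\<alpha>, b)" by force
      have "wt 0 \<alpha> + deg b \<le> n - 1"
        using q le[of q] by (auto simp: M1_def w_def)
      moreover have "mon 0 \<alpha> b \<in> G (deg b + wt 0 \<alpha>)"
        using q deg[of \<alpha> b] B(1) by (intro mon_G) (auto simp: M'_def)
      ultimately have "mon 0 \<alpha> b \<in> G (n - 1)"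
        using G_mono[of "deg b + wt 0 \<alpha>" "n - 1"] by auto
      then show "?f q \<in> G (n - 1)"
        using subspace_scale[OF subspace_G] by simp
    qed
    ultimately have sumM1: "sum ?f M1 \<in> J 0 n"
      using G_uminus[of "sum ?f (M' - M1)" "n - 1"] by (simp add: J_def eq_neg_iff_add_eq_0[symmetric])
    define A where "A = fst ` M1"
    \<comment> \<open>Terms with the same exponent are collected. Having total weight
      \<open>n\<close>, their vectors all come from \<open>B (n - wt 0 \<alpha>)\<close>, so
      \<open>v \<alpha>\<close> lies in the span of that one set.\<close>
    define v where "v \<alpha> = (\<Sum>b\<in>{b. (\<alpha>, b) \<in> M1}. scale (cf (\<alpha>, b)) b)" for \<alpha>
    have finM1: "finite M1" using M' by (simp add: M1_def)
    have M1_Sigma: "M1 = Sigma A (\<lambda>\<alpha>. {b. (\<alpha>, b) \<in> M1})"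
      by (force simp: A_def)
    have fin: "finite A" "finite {b. (\<alpha>, b) \<in> M1}" for \<alpha>
    proof -
      show "finite A" using finM1 by (simp add: A_def)
      have "{b. (\<alpha>, b) \<in> M1} \<subseteq> snd ` M1" by force
      then show "finite {b. (\<alpha>, b) \<in> M1}" using finM1 finite_subset by blast
    qed
    have "sum ?f M1 = (\<Sum>\<alpha>\<in>A. \<Sum>b\<in>{b. (\<alpha>, b) \<in> M1}. scale (cf (\<alpha>, b)) (mon 0 \<alpha> b))"
      by (subst M1_Sigma, subst sum.Sigma) (use fin in auto)
    also have "\<dots> = (\<Sum>\<alpha>\<in>A. mon 0 \<alpha> (v \<alpha>))"
      by (simp add: v_def mon_sum mon_linear)
    finally have "(\<Sum>\<alpha>\<in>A. mon 0 \<alpha> (v \<alpha>)) \<in> J 0 n" using sumM1 by simp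
    have sub: "{b. (\<alpha>, b) \<in> M1} \<subseteq> B (n - wt 0 \<alpha>)" for \<alpha>
    proof
      fix b assume "b \<in> {b. (\<alpha>, b) \<in> M1}"
      then have "(\<alpha>, b) \<in> M" "deg b = n - wt 0 \<alpha>" by (auto simp: M1_def M'_def w_def)
      then show "b \<in> B (n - wt 0 \<alpha>)" using deg by metis
    qed
    have "\<forall>\<alpha>\<in>A. v \<alpha> = 0"
    proof (rule mon_independent_mod[OF exact, of "\<lambda>n. span (B n)" 0 A v n])
      show "span (B n) \<subseteq> G n" for n using span_minimal[OF B(1) subspace_G] .
      show "span (B n) \<inter> J t n = {0}" for n by (rule B(3))
      show "\<alpha> j = 0" if "\<alpha> \<in> A" "j < 0 \<or> t \<le> j" for \<alpha> j
        using that M(2) by (auto simp: A_def M1_def M'_def)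
      show "v \<alpha> \<in> span (B (n - wt 0 \<alpha>))" if "\<alpha> \<in> A" for \<alpha>
        unfolding v_def using sub[of \<alpha>] by (intro span_sum span_scale) (auto intro: span_base)
    qed (use fin \<open>(\<Sum>\<alpha>\<in>A. mon 0 \<alpha> (v \<alpha>)) \<in> J 0 n\<close> in auto)
    moreover have "(\<alpha>0, b0) \<in> M1" using p0 by (simp add: M1_def)
    ultimately have "(\<Sum>b\<in>{b. (\<alpha>0, b) \<in> M1}. scale (cf (\<alpha>0, b)) b) = 0"
      unfolding v_def A_def by force
    then have "cf (\<alpha>0, b0) = 0"
      using independentD[OF B(2) fin(2)[of \<alpha>0] sub[of \<alpha>0], where u = "\<lambda>b. cf (\<alpha>0, b)" and v = b0] \<open>(\<alpha>0, b0) \<in> M1\<close> by simp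
    then show False using p0 by (simp add: M'_def)
  qed
  show ?thesis
    by (rule that[of "\<Union>n. B n"]) (fact 1, fact 2)
qed

end

section \<open>From monomials to bases over a subring\<close>

context filtered_operators begin

text \<open>\<open>f\<close> may identify indices, so the coefficients are carried by a subset of
  \<open>I\<close> on which it is injective. In the application \<open>f\<close> sends an exponent
  to its monomial.\<close>

lemma in_span_image:
  assumes "x \<in> span (f ` I)"
  obtains A r where "finite A" "A \<subseteq> I" "x = (\<Sum>a\<in>A. scale (r a) (f a))"
proof -
  obtain T r where T: "finite T" "T \<subseteq> f ` I" "x = (\<Sum>a\<in>T. scale (r a) a)"
    using assms unfolding span_explicit by blast
  then obtain A where A: "A \<subseteq> I" "inj_on f A" "T = f ` A"
    using subset_image_inj[of T f I] by blast
  have "x = (\<Sum>a\<in>A. scale (r (f a)) (f a))"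
    unfolding T(3) A(3) by (simp add: sum.reindex[OF A(2)])
  moreover have "finite A"
    using T(1) A(2,3) finite_imageD by blast
  ultimately show ?thesis
    using that[of A "\<lambda>a. r (f a)"] A(1) by blast
qed

text \<open>The product \<open>m c b\<close> stands for \<open>c * b\<close> or for \<open>b * c\<close>.\<close>

lemma free_module_basis:
  fixes m :: "'a \<Rightarrow> 'a \<Rightarrow> 'a" and e :: 'a
  assumes exact: "koszul_exact t"
    and sub: "subspace \<Gamma>" and one: "e \<in> \<Gamma>" and op_\<Gamma>: "\<And>j c. j < t \<Longrightarrow> c \<in> \<Gamma> \<Longrightarrow> op j c \<in> \<Gamma>"
    and \<Gamma>_span: "\<Gamma> \<subseteq> span ((\<lambda>\<alpha>. mon 0 \<alpha> e) ` {\<alpha>. \<forall>j\<ge>t. \<alpha> j = 0})"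
    and m_add: "\<And>x y b. m (x + y) b = m x b + m y b"
    and m_scale: "\<And>k x b. m (scale k x) b = scale k (m x b)"
    and m_one: "\<And>b. m e b = b"
    and op_m: "\<And>j c b. j < t \<Longrightarrow> op j (m c b) = m (op j c) b"
  shows "\<exists>B. \<forall>u. \<exists>!c. (\<forall>b. c b \<in> \<Gamma>) \<and> (\<forall>b. b \<notin> B \<longrightarrow> c b = 0) \<and>
    finite {b. c b \<noteq> 0} \<and> u = (\<Sum>b | c b \<noteq> 0. m (c b) b)"
proof -
  obtain B where B:
    "\<And>S. subspace S \<Longrightarrow> B \<subseteq> S \<Longrightarrow> (\<And>j x. j < t \<Longrightarrow> x \<in> S \<Longrightarrow> op j x \<in> S) \<Longrightarrow> S = UNIV"
    "\<And>M cf p. finite M \<Longrightarrow> (\<And>\<alpha> b. (\<alpha>, b) \<in> M \<Longrightarrow> b \<in> B \<and> (\<forall>j\<ge>t. \<alpha> j = 0)) \<Longrightarrow>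
       (\<Sum>(\<alpha>, b)\<in>M. scale (cf (\<alpha>, b)) (mon 0 \<alpha> b)) = 0 \<Longrightarrow> p \<in> M \<Longrightarrow> cf p = 0"
    by (rule monomial_basis[OF exact]) blast
  have m_zero: "m 0 b = 0" for b
    using m_scale[of 0 0 b] by simp
  have m_uminus: "m (- x) b = - m x b" for x b
    using m_add[of x "- x" b] m_zero[of b] by (simp add: eq_neg_iff_add_eq_0 add.commute)
  have m_diff: "m (x - y) b = m x b - m y b" for x y b
    using m_add[of x "- y" b] m_uminus[of y b] by simp
  have m_sum: "m (sum f A) b = (\<Sum>i\<in>A. m (f i) b)" for f :: "'i \<Rightarrow> 'a" and A b
    by (induction A rule: infinite_finite_induct) (auto simp: m_zero m_add)
  \<comment> \<open>As \<open>m e b = b\<close> and the operators act on the first argument of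
    \<open>m\<close>, applying a monomial to \<open>b\<close> is multiplying \<open>b\<close> by an
    element of \<open>\<Gamma>\<close>.\<close>
  have m_mon: "mon 0 \<alpha> b = m (mon 0 \<alpha> e) b" for \<alpha> b
  proof -
    have *: "(op s ^^ k) (m c b) = m ((op s ^^ k) c) b" if "s < t" for s k c
      by (induction k) (auto simp: op_m that)
    have "mon s \<alpha> b = m (mon s \<alpha> e) b" if "s \<le> t" for s
      using that by (induction rule: inc_induct) (auto simp: mon_top mon_rec m_one *)
    then show ?thesis by simp
  qed
  define rep where "rep u c \<longleftrightarrow> (\<forall>b. c b \<in> \<Gamma>) \<and> (\<forall>b. b \<notin> B \<longrightarrow> c b = 0) \<and>
    finite {b. c b \<noteq> 0} \<and> u = (\<Sum>b | c b \<noteq> 0. m (c b) b)" for u c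
  have sum_super: "(\<Sum>b | c b \<noteq> 0. m (c b) b) = (\<Sum>b\<in>A. m (c b) b)"
    if "finite A" "{b. c b \<noteq> 0} \<subseteq> A" for c A
    using that by (intro sum.mono_neutral_left) (auto simp: m_zero)
  have repI: "rep u c" if "\<And>b. c b \<in> \<Gamma>" "\<And>b. b \<notin> A \<Longrightarrow> c b = 0" "finite A" "A \<subseteq> B"
    "u = (\<Sum>b\<in>A. m (c b) b)" for u c A
  proof -
    have "{b. c b \<noteq> 0} \<subseteq> A" using that(2) by blast
    moreover have "finite {b. c b \<noteq> 0}"
      using calculation that(3) by (rule finite_subset)
    moreover have "c b = 0" if "b \<notin> B" for b
      using \<open>A \<subseteq> B\<close> that \<open>\<And>b. b \<notin> A \<Longrightarrow> c b = 0\<close> by blast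
    ultimately show ?thesis
      unfolding rep_def using that(1,5) sum_super[OF that(3), of c] by simp
  qed
  have repE: "\<exists>A. finite A \<and> A \<subseteq> B \<and> (\<forall>b. b \<notin> A \<longrightarrow> c b = 0) \<and> (\<forall>b. c b \<in> \<Gamma>) \<and> u = (\<Sum>b\<in>A. m (c b) b)"
    if "rep u c" for u c
  proof (intro exI[of _ "{b. c b \<noteq> 0}"] conjI)
  qed (use that in \<open>auto simp: rep_def\<close>)
  have "{u. \<exists>c. rep u c} = UNIV"
  proof (rule B(1))
    show "subspace {u. \<exists>c. rep u c}"
    proof (rule subspaceI)
      have "rep 0 (\<lambda>_. 0)"
        by (rule repI[of _ "{}"]) (auto simp: subspace_0[OF sub])
      then show "0 \<in> {u. \<exists>c. rep u c}" by blast
    next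
      fix x y assume "x \<in> {u. \<exists>c. rep u c}" "y \<in> {u. \<exists>c. rep u c}"
      then obtain c c' where "rep x c" "rep y c'" by blast
      from repE[OF this(1)] repE[OF this(2)] obtain A A' where
        A: "finite A" "A \<subseteq> B" "\<forall>b. b \<notin> A \<longrightarrow> c b = 0" "\<forall>b. c b \<in> \<Gamma>" "x = (\<Sum>b\<in>A. m (c b) b)" and
        A': "finite A'" "A' \<subseteq> B" "\<forall>b. b \<notin> A' \<longrightarrow> c' b = 0" "\<forall>b. c' b \<in> \<Gamma>" "y = (\<Sum>b\<in>A'. m (c' b) b)"
        by blast
      have "x = (\<Sum>b\<in>A \<union> A'. m (c b) b)" "y = (\<Sum>b\<in>A \<union> A'. m (c' b) b)"
        unfolding A(5) A'(5) using A A' by (auto intro!: sum.mono_neutral_left simp: m_zero)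
      then have "rep (x + y) (\<lambda>b. c b + c' b)"
        using A A' by (intro repI[of _ "A \<union> A'"]) (auto simp: m_add sum.distrib subspace_add[OF sub])
      then show "x + y \<in> {u. \<exists>c. rep u c}" by blast
    next
      fix k x assume "x \<in> {u. \<exists>c. rep u c}"
      then obtain c where "rep x c" by blast
      from repE[OF this] obtain A where
        A: "finite A" "A \<subseteq> B" "\<forall>b. b \<notin> A \<longrightarrow> c b = 0" "\<forall>b. c b \<in> \<Gamma>" "x = (\<Sum>b\<in>A. m (c b) b)"
        by blast
      then have "rep (scale k x) (\<lambda>b. scale k (c b))"
        by (intro repI[of _ A]) (auto simp: m_scale scale_sum_right subspace_scale[OF sub])
      then show "scale k x \<in> {u. \<exists>c. rep u c}" by blast
    qed
    show "B \<subseteq> {u. \<exists>c. rep u c}"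
    proof
      fix b assume "b \<in> B"
      then have "rep b (\<lambda>b'. if b' = b then e else 0)"
        by (intro repI[of _ "{b}"]) (auto simp: one subspace_0[OF sub] m_one)
      then show "b \<in> {u. \<exists>c. rep u c}" by blast
    qed
    show "op j x \<in> {u. \<exists>c. rep u c}" if j: "j < t" and x: "x \<in> {u. \<exists>c. rep u c}" for j x
    proof -
      obtain c where "rep x c" using x by blast
      from repE[OF this] obtain A where
        A: "finite A" "A \<subseteq> B" "\<forall>b. b \<notin> A \<longrightarrow> c b = 0" "\<forall>b. c b \<in> \<Gamma>" "x = (\<Sum>b\<in>A. m (c b) b)"
        by blast
      then have "rep (op j x) (\<lambda>b. op j (c b))"
        by (intro repI[of _ A]) (auto simp: op_sum[OF j] op_zero[OF j] op_m[OF j] op_\<Gamma>[OF j])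
      then show ?thesis by blast
    qed
  qed
  then have ex: "\<exists>c. rep u c" for u by blast
  have unique: "c = c'" if cc': "rep u c" "rep u c'" for u c c'
  proof -
    from repE[OF cc'(1)] repE[OF cc'(2)] obtain A A' where
      A: "finite A" "A \<subseteq> B" "\<forall>b. b \<notin> A \<longrightarrow> c b = 0" "\<forall>b. c b \<in> \<Gamma>" "u = (\<Sum>b\<in>A. m (c b) b)" and
      A': "finite A'" "A' \<subseteq> B" "\<forall>b. b \<notin> A' \<longrightarrow> c' b = 0" "\<forall>b. c' b \<in> \<Gamma>" "u = (\<Sum>b\<in>A'. m (c' b) b)"
      by blast
    have u: "u = (\<Sum>b\<in>A \<union> A'. m (c b) b)" "u = (\<Sum>b\<in>A \<union> A'. m (c' b) b)"
      using A(1,3,5) A'(1,3,5) sum.mono_neutral_left[of "A \<union> A'" A "\<lambda>b. m (c b) b"]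
        sum.mono_neutral_left[of "A \<union> A'" A' "\<lambda>b. m (c' b) b"] by (auto simp: m_zero)
    define z where "z b = c b - c' b" for b
    have z0: "(\<Sum>b\<in>A \<union> A'. m (z b) b) = 0"
      using u by (simp add: z_def m_diff sum_subtractf)
    \<comment> \<open>Expanding each difference of coefficients in monomials applied to
      \<open>e\<close> turns a relation over \<open>\<Gamma>\<close> into one over the field. The
      pair \<open>Q\<close> holds the exponents and their coefficients, so that one choice yields
      both.\<close>
    have "\<exists>Q. finite (fst Q) \<and> fst Q \<subseteq> {\<alpha>. \<forall>j\<ge>t. \<alpha> j = 0} \<and>
        z b = (\<Sum>\<alpha>\<in>fst Q. scale (snd Q \<alpha>) (mon 0 \<alpha> e))" for b
    proof -
      have "z b \<in> \<Gamma>" using A(4) A'(4) subspace_diff[OF sub] by (auto simp: z_def)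
      then have "z b \<in> span ((\<lambda>\<alpha>. mon 0 \<alpha> e) ` {\<alpha>. \<forall>j\<ge>t. \<alpha> j = 0})" using \<Gamma>_span by blast
      then obtain P r where "finite P" "P \<subseteq> {\<alpha>. \<forall>j\<ge>t. \<alpha> j = 0}"
        "z b = (\<Sum>\<alpha>\<in>P. scale (r \<alpha>) (mon 0 \<alpha> e))"
        by (rule in_span_image)
      then show ?thesis by (intro exI[of _ "(P, r)"]) simp
    qed
    from choice[OF allI[OF this]] obtain Q where Q: "\<forall>b. finite (fst (Q b)) \<and>
        fst (Q b) \<subseteq> {\<alpha>. \<forall>j\<ge>t. \<alpha> j = 0} \<and>
        z b = (\<Sum>\<alpha>\<in>fst (Q b). scale (snd (Q b) \<alpha>) (mon 0 \<alpha> e))"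
      by (rule exE)
    define P where "P b = fst (Q b)" for b
    define r where "r b = snd (Q b)" for b
    have P: "finite (P b)" "P b \<subseteq> {\<alpha>. \<forall>j\<ge>t. \<alpha> j = 0}"
      and z: "z b = (\<Sum>\<alpha>\<in>P b. scale (r b \<alpha>) (mon 0 \<alpha> e))" for b
      using spec[OF Q, of b] unfolding P_def r_def by simp_all
    define M where "M = prod.swap ` Sigma (A \<union> A') P"
    define cf where "cf = (\<lambda>(\<alpha>, b). r b \<alpha>)"
    have "(\<Sum>(\<alpha>, b)\<in>M. scale (cf (\<alpha>, b)) (mon 0 \<alpha> b)) =
        (\<Sum>(b, \<alpha>)\<in>Sigma (A \<union> A') P. scale (r b \<alpha>) (mon 0 \<alpha> b))"
      unfolding M_def by (subst sum.reindex) (auto simp: cf_def intro!: sum.cong)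
    also have "\<dots> = (\<Sum>b\<in>A \<union> A'. \<Sum>\<alpha>\<in>P b. scale (r b \<alpha>) (mon 0 \<alpha> b))"
      using A(1) A'(1) P(1) by (subst sum.Sigma) auto
    also have "\<dots> = (\<Sum>b\<in>A \<union> A'. m (z b) b)"
      by (simp only: z m_sum m_scale m_mon[symmetric])
    finally have "(\<Sum>(\<alpha>, b)\<in>M. scale (cf (\<alpha>, b)) (mon 0 \<alpha> b)) = 0" using z0 by simp
    moreover have "finite M" unfolding M_def using A(1) A'(1) P(1) by auto
    moreover have "b \<in> B \<and> (\<forall>j\<ge>t. \<alpha> j = 0)" if "(\<alpha>, b) \<in> M" for \<alpha> b
      using that A(2) A'(2) P(2)[of b] by (auto simp: M_def)
    ultimately have cf: "cf p = 0" if "p \<in> M" for p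
      using B(2)[of M cf p] that by blast
    have "z b = 0" for b
    proof (cases "b \<in> A \<union> A'")
      case True
      have "r b \<alpha> = 0" if "\<alpha> \<in> P b" for \<alpha>
      proof -
        have "(\<alpha>, b) \<in> M" unfolding M_def using True that by force
        then show ?thesis using cf[of "(\<alpha>, b)"] by (simp add: cf_def)
      qed
      then show ?thesis by (simp add: z)
    next
      case False
      then show ?thesis using A(3) A'(3) by (simp add: z_def)
    qed
    then show ?thesis by (auto simp: z_def)
  qed
  have "\<exists>!c. rep u c" for u
    using ex unique by blast
  then show ?thesis
    unfolding rep_def by (intro exI[of _ B] allI)
qed

end

section \<open>From the operators to the algebra\<close>

context assoc_algebra begin

lemma generated_subalgebra_is_subalgebra: "subalgebra (generated_subalgebra X)"
proof -
  have "subalgebra (\<Inter>T)" if "\<forall>S\<in>T. subalgebra S" for T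
  proof -
    have "subspace (\<Inter>T)" using that by (intro subspace_Inter) (auto simp: subalgebra_def)
    then show ?thesis using that by (auto simp: subalgebra_def)
  qed
  then show ?thesis unfolding generated_subalgebra_def by (rule hull_in)
qed

lemma generated_subalgebra_subset: "X \<subseteq> generated_subalgebra X"
  unfolding generated_subalgebra_def by (rule hull_subset)

lemma generated_subalgebra_minimal: "X \<subseteq> S \<Longrightarrow> subalgebra S \<Longrightarrow> generated_subalgebra X \<subseteq> S"
  unfolding generated_subalgebra_def by (rule hull_minimal)

lemma mult_scale_one: "scale k 1 * x = scale k x"
  using scale_mult_left[of k 1 x] by simp

text \<open>A containment test: once the generators lie in this set, so does the subalgebra they
  generate, and evaluation at \<open>1 \<in> V\<close> places that subalgebra inside
  \<open>V\<close>.\<close>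

lemma subalgebra_left_multipliers:
  assumes "subspace V"
  shows "subalgebra {x. \<forall>y\<in>V. x * y \<in> V}"
  unfolding subalgebra_def
  using subspace_0[OF assms] subspace_add[OF assms] subspace_scale[OF assms]
  by (auto simp: subspace_def distrib_right scale_mult_left[symmetric] mult.assoc)

lemma subalgebra_right_multipliers:
  assumes "subspace V"
  shows "subalgebra {x. \<forall>y\<in>V. y * x \<in> V}"
  unfolding subalgebra_def
  using subspace_0[OF assms] subspace_add[OF assms] subspace_scale[OF assms]
  by (auto simp: subspace_def distrib_left scale_mult_right[symmetric] mult.assoc[symmetric])

end

section \<open>Left and right multiplication as operators\<close>

context filtered_algebra begin

text \<open>The continuation by zero makes \<open>filt_pred F n\<close> equal to
  \<open>G (int n - 1)\<close> for every \<open>n\<close>, including \<open>n = 0\<close>.\<close>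

definition G :: "int \<Rightarrow> 'a set" where
  "G n = (if n < 0 then {0} else F (nat n))"

lemma subspace_G: "subspace (G n)"
  by (simp add: G_def filt_subspace)

lemma G_neg: "n < 0 \<Longrightarrow> G n = {0}"
  by (simp add: G_def)

lemma G_of_nat: "G (int n) = F n"
  by (simp add: G_def)

lemma filt_pred_eq_G: "filt_pred F n = G (int n - 1)"
  by (auto simp: filt_pred_def G_def split: nat.splits)

lemma G_mono: "m \<le> n \<Longrightarrow> G m \<subseteq> G n"
  using filt_mono[of "nat m" "nat n"] subspace_0[OF filt_subspace] by (auto simp: G_def)

lemma G_mult:
  assumes "x \<in> G m" "y \<in> G n"
  shows "x * y \<in> G (m + n)"
proof (cases "m < 0 \<or> n < 0")
  case True
  then show ?thesis using assms subspace_0[OF subspace_G] by (auto simp: G_neg)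
next
  case False
  then show ?thesis using filt_mult[of x "nat m" y "nat n"] assms
    by (simp add: G_def nat_add_distrib)
qed

lemma G_exhaustive: "\<exists>n. x \<in> G n"
  using filt_exhaustive by (metis G_of_nat UN_iff UNIV_I)

text \<open>Since the Koszul complex consists of left modules, \<open>exact\<close> speaks of
  multiplication by \<open>g ! j\<close> on the right, which governs the right module. For the left
  module the factors are exchanged, at the cost of terms of lower degree by
  \<open>lower\<close>.\<close>

lemma free_over_generated_subalgebra:
  fixes g :: "'a list"
  defines "t \<equiv> length g"
  assumes lower: "\<And>x y m n. x \<in> G m \<Longrightarrow> y \<in> G n \<Longrightarrow> x * y - y * x \<in> G (m + n - 1)"
    and commute: "\<forall>x\<in>set g. \<forall>y\<in>set g. x * y = y * x"
    and d: "\<And>j. j < t \<Longrightarrow> g ! j \<in> G (d j)" "\<And>j. j < t \<Longrightarrow> 0 < d j"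
    and exact: "\<And>n a. (\<And>j. j < t \<Longrightarrow> a j \<in> G (n - d j)) \<Longrightarrow> (\<Sum>j<t. a j * g ! j) \<in> G (n - 1) \<Longrightarrow>
      \<exists>c. (\<forall>i<t. c i i = 0) \<and> (\<forall>i<t. \<forall>j<t. c i j \<in> G (n - d i - d j)) \<and>
        (\<forall>i<t. \<forall>j<t. c i j + c j i = 0) \<and>
        (\<forall>i<t. a i - (\<Sum>j<t. c i j * g ! j) \<in> G (n - d i - 1))"
  shows "free_as_left_module (generated_subalgebra (set g))"
    and "free_as_right_module (generated_subalgebra (set g))"
proof -
  let ?\<Gamma> = "generated_subalgebra (set g)"
  have \<Gamma>: "subspace ?\<Gamma>" "1 \<in> ?\<Gamma>" "\<And>x y. x \<in> ?\<Gamma> \<Longrightarrow> y \<in> ?\<Gamma> \<Longrightarrow> x * y \<in> ?\<Gamma>"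
    using generated_subalgebra_is_subalgebra[of "set g"] by (auto simp: subalgebra_def)
  have g\<Gamma>: "g ! j \<in> ?\<Gamma>" if "j < t" for j
    using generated_subalgebra_subset[of "set g"] that by (auto simp: t_def)
  have gcomm: "g ! i * g ! j = g ! j * g ! i" if "i < t" "j < t" for i j
    using commute that by (simp add: t_def)
  interpret L: filtered_operators scale G t "\<lambda>j x. g ! j * x" d
  proof
    show "g ! j * x \<in> G (n + d j)" if "j < t" "x \<in> G n" for j x n
      using G_mult[OF d(1)[OF that(1)] that(2)] by (simp add: add.commute)
  qed (auto simp: subspace_G G_neg G_exhaustive distrib_left scale_mult_right d(2) gcomm mult.assoc[symmetric]
        dest: subsetD[OF G_mono])
  interpret R: filtered_operators scale G t "\<lambda>j x. x * g ! j" d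
  proof
    show "x * g ! j \<in> G (n + d j)" if "j < t" "x \<in> G n" for j x n
      using G_mult[OF that(2) d(1)[OF that(1)]] by simp
  qed (auto simp: subspace_G G_neg G_exhaustive distrib_right scale_mult_left d(2) gcomm mult.assoc
        dest: subsetD[OF G_mono])
  have R_exact: "R.koszul_exact t"
    unfolding R.koszul_exact_def R.bounds_def using exact by blast
  have L_exact: "L.koszul_exact t"
    unfolding L.koszul_exact_def
  proof (intro allI impI)
    fix n a assume a: "\<forall>j<t. a j \<in> G (n - d j)" "(\<Sum>j<t. g ! j * a j) \<in> G (n - 1)"
    have "a j * g ! j - g ! j * a j \<in> G (n - 1)" if "j < t" for j
      using lower[of "a j" "n - d j" "g ! j" "d j"] a(1) d(1) that by simp
    then have "(\<Sum>j<t. a j * g ! j - g ! j * a j) \<in> G (n - 1)"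
      by (intro L.G_sum) auto
    then have "(\<Sum>j<t. a j * g ! j) \<in> G (n - 1)"
      using L.G_add[OF _ a(2)] by (fastforce simp: sum_subtractf)
    then obtain c where "R.bounds t n a c"
      using R_exact a(1) unfolding R.koszul_exact_def by blast
    note c = R.boundsD[OF this]
    \<comment> \<open>The chain found for right multiplication also serves on the left: exchanging
      \<open>c i j\<close> and \<open>g ! j\<close> only produces terms of degree below
      \<open>n - d i\<close>.\<close>
    have "a i - (\<Sum>j<t. g ! j * c i j) \<in> G (n - d i - 1)" if "i < t" for i
    proof -
      have "c i j * g ! j - g ! j * c i j \<in> G (n - d i - 1)" if "j < t" for j
        using lower[of "c i j" "n - d i - d j" "g ! j" "d j"] c(2) d(1) that \<open>i < t\<close> by simp
      then have "(\<Sum>j<t. c i j * g ! j - g ! j * c i j) \<in> G (n - d i - 1)"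
        by (intro L.G_sum) auto
      then show ?thesis
        using L.G_add[OF c(4)[OF that]] by (fastforce simp: sum_subtractf)
    qed
    then show "\<exists>c. L.bounds t n a c"
      using c(1-3) unfolding L.bounds_def by (intro exI[of _ c]) blast
  qed
  have L_span: "?\<Gamma> \<subseteq> span ((\<lambda>\<alpha>. L.mon 0 \<alpha> 1) ` {\<alpha>. \<forall>j\<ge>t. \<alpha> j = 0})" (is "_ \<subseteq> span ?M")
  proof -
    have one: "1 \<in> span ?M"
    proof -
      have "L.mon 0 (\<lambda>_. 0) 1 = 1"
        by (simp add: L.mon_def foldr_conv_fold fold_id)
      then show ?thesis
        by (intro span_base image_eqI[of _ _ "\<lambda>_. 0"]) auto
    qed
    have "g ! j * y \<in> span ?M" if "j < t" "y \<in> span ?M" for j y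
      using that(2)
    proof (induction rule: span_induct)
      case base
      show ?case
        by (auto simp: subspace_def distrib_left scale_mult_right[symmetric] intro: span_add span_scale span_zero)
    next
      case (step x)
      then obtain \<alpha> where \<alpha>: "\<forall>j\<ge>t. \<alpha> j = 0" "x = L.mon 0 \<alpha> 1" by auto
      then have "g ! j * x = L.mon 0 (\<alpha>(j := Suc (\<alpha> j))) 1"
        using L.op_mon[of 0 j] that(1) by simp
      then show ?case
        using \<alpha>(1) that(1) by (auto intro!: span_base image_eqI[of _ _ "\<alpha>(j := Suc (\<alpha> j))"])
    qed
    then have "set g \<subseteq> {x. \<forall>y\<in>span ?M. x * y \<in> span ?M}"
      by (auto simp: in_set_conv_nth t_def)
    then have "?\<Gamma> \<subseteq> {x. \<forall>y\<in>span ?M. x * y \<in> span ?M}"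
      by (intro generated_subalgebra_minimal subalgebra_left_multipliers) auto
    then show ?thesis using one by force
  qed
  show "free_as_left_module ?\<Gamma>"
    unfolding free_as_left_module_def left_basis_def
    by (rule L.free_module_basis[OF L_exact \<Gamma>(1,2) _ L_span, where m = "(*)"])
      (auto simp: \<Gamma>(3) g\<Gamma> distrib_right scale_mult_left mult.assoc)
  have R_span: "?\<Gamma> \<subseteq> span ((\<lambda>\<alpha>. R.mon 0 \<alpha> 1) ` {\<alpha>. \<forall>j\<ge>t. \<alpha> j = 0})" (is "_ \<subseteq> span ?M")
  proof -
    have one: "1 \<in> span ?M"
    proof -
      have "R.mon 0 (\<lambda>_. 0) 1 = 1"
        by (simp add: R.mon_def foldr_conv_fold fold_id)
      then show ?thesis
        by (intro span_base image_eqI[of _ _ "\<lambda>_. 0"]) auto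
    qed
    have "y * g ! j \<in> span ?M" if "j < t" "y \<in> span ?M" for j y
      using that(2)
    proof (induction rule: span_induct)
      case base
      show ?case
        by (auto simp: subspace_def distrib_right scale_mult_left[symmetric] intro: span_add span_scale span_zero)
    next
      case (step x)
      then obtain \<alpha> where \<alpha>: "\<forall>j\<ge>t. \<alpha> j = 0" "x = R.mon 0 \<alpha> 1" by auto
      then have "x * g ! j = R.mon 0 (\<alpha>(j := Suc (\<alpha> j))) 1"
        using R.op_mon[of 0 j] that(1) by simp
      then show ?case
        using \<alpha>(1) that(1) by (auto intro!: span_base image_eqI[of _ _ "\<alpha>(j := Suc (\<alpha> j))"])
    qed
    then have "set g \<subseteq> {x. \<forall>y\<in>span ?M. y * x \<in> span ?M}"
      by (auto simp: in_set_conv_nth t_def)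
    then have "?\<Gamma> \<subseteq> {x. \<forall>y\<in>span ?M. y * x \<in> span ?M}"
      by (intro generated_subalgebra_minimal subalgebra_right_multipliers) auto
    then show ?thesis using one by force
  qed
  show "free_as_right_module ?\<Gamma>"
    unfolding free_as_right_module_def right_basis_def
    by (rule R.free_module_basis[OF R_exact \<Gamma>(1,2) _ R_span, where m = "\<lambda>c b. b * c"])
      (auto simp: \<Gamma>(3) g\<Gamma> distrib_left scale_mult_right mult.assoc)
qed

end

section \<open>The associated graded algebra\<close>

context filtered_algebra begin

abbreviation P :: "nat \<Rightarrow> 'a set" where "P \<equiv> filt_pred F"
abbreviation gr where "gr \<equiv> gr_algebra scale F"

lemma subspace_P: "subspace (P n)"
  by (simp add: filt_pred_eq_G subspace_G)

lemma P_subset_F: "P n \<subseteq> F n"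
  using G_mono[of "int n - 1" "int n"] by (simp add: filt_pred_eq_G G_of_nat)

lemma coset_eq_iff: "u +o P n = v +o P n \<longleftrightarrow> u - v \<in> P n"
proof
  assume "u +o P n = v +o P n"
  moreover have "u \<in> u +o P n"
    using subspace_0[OF subspace_P] by (force simp: elt_set_plus_def)
  ultimately show "u - v \<in> P n" by (auto simp: elt_set_plus_def)
next
  have *: "u +o P n \<subseteq> v +o P n" if "u - v \<in> P n" for u v
  proof
    fix x assume "x \<in> u +o P n"
    then obtain p where "p \<in> P n" "x = u + p" by (auto simp: elt_set_plus_def)
    then have "x = v + (u - v + p)" "u - v + p \<in> P n"
      using that subspace_add[OF subspace_P] by auto
    then show "x \<in> v +o P n" unfolding elt_set_plus_def by blast
  qed
  assume "u - v \<in> P n"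
  moreover from this have "v - u \<in> P n"
    using subspace_neg[OF subspace_P] by fastforce
  ultimately show "u +o P n = v +o P n" using * by blast
qed

lemma coset_zero: "0 +o P n = P n"
  by (force simp: elt_set_plus_def)

lemma coset_add: "(u +o P n) + (v +o P n) = (u + v) +o P n"
proof -
  have "P n + P n = P n"
    using subspace_add[OF subspace_P] subspace_0[OF subspace_P] by (force simp: set_plus_def)
  then show ?thesis by (simp add: set_plus_rearrange)
qed

lemma coset_sum:
  "finite I \<Longrightarrow> I \<noteq> {} \<Longrightarrow> (\<Sum>i\<in>I. u i +o P n) = (\<Sum>i\<in>I. u i) +o P n"
  by (induction I rule: finite_ne_induct) (auto simp: coset_add)

text \<open>The union over all representatives collapses to one coset: changing \<open>u\<close> by
  \<open>p\<close> and \<open>v\<close> by \<open>q\<close> changes the product by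
  \<open>u * q + p * v'\<close>, which has degree below \<open>i + j\<close>.\<close>

lemma gr_component_mult_coset:
  assumes "u \<in> F i" "v \<in> F j"
  shows "gr_component_mult F i j (u +o P i) (v +o P j) = (u * v) +o P (i + j)"
proof -
  have "(u' * v') +o P (i + j) = (u * v) +o P (i + j)" if u': "u' \<in> u +o P i" and v': "v' \<in> v +o P j" for u' v'
  proof -
    obtain p q where p: "p \<in> P i" "u' = u + p" and q: "q \<in> P j" "v' = v + q"
      using u' v' by (auto simp: elt_set_plus_def)
    have "u * q \<in> P (i + j)"
      using G_mult[of u "int i" q "int j - 1"] assms(1) q(1)
      by (simp add: filt_pred_eq_G G_of_nat algebra_simps)
    moreover have "p * v' \<in> P (i + j)"
    proof -
      have "v' \<in> F j"
        using q assms(2) P_subset_F subspace_add[OF filt_subspace] by blast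
      then show ?thesis
        using G_mult[of p "int i - 1" v' "int j"] p(1)
        by (simp add: filt_pred_eq_G G_of_nat algebra_simps)
    qed
    ultimately have "u * q + p * v' \<in> P (i + j)"
      by (rule subspace_add[OF subspace_P])
    then show ?thesis
      unfolding coset_eq_iff p(2) q(2) by (simp add: algebra_simps)
  qed
  moreover have "u \<in> u +o P i" "v \<in> v +o P j"
    using subspace_0[OF subspace_P] by (force simp: elt_set_plus_def)+
  ultimately show ?thesis
    unfolding gr_component_mult_def by blast
qed

text \<open>Elements of the graded algebra are handled through families of representatives of their
  components.\<close>

definition reps :: "(nat \<Rightarrow> 'a) set" where
  "reps = {w. (\<forall>i. w i \<in> F i) \<and> finite {i. w i \<noteq> 0}}"

definition cls :: "(nat \<Rightarrow> 'a) \<Rightarrow> nat \<Rightarrow> 'a set" where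
  "cls w = (\<lambda>i. w i +o P i)"

lemma cls_eq_iff: "cls v = cls w \<longleftrightarrow> (\<forall>i. v i - w i \<in> P i)"
  by (simp add: cls_def fun_eq_iff coset_eq_iff)

lemma carrier_gr: "carrier gr = cls ` reps"
proof (intro equalityI subsetI)
  fix x assume "x \<in> carrier gr"
  then have x: "\<And>i. x i \<in> gr_component F i" "finite {i. x i \<noteq> P i}"
    by (auto simp: gr_algebra_def)
  have "\<exists>u. u \<in> F i \<and> x i = u +o P i" for i
    using x(1)[of i] by (auto simp: gr_component_def)
  then obtain u where u: "\<And>i. u i \<in> F i" "\<And>i. x i = u i +o P i" by metis
  \<comment> \<open>Reset to zero where the class vanishes, since arbitrary representatives could
    have infinite support.\<close>
  define w where "w i = (if x i = P i then 0 else u i)" for i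
  have "finite {i. w i \<noteq> 0}"
    using x(2) by (rule finite_subset[rotated]) (auto simp: w_def)
  then have "w \<in> reps"
    using u(1) subspace_0[OF filt_subspace] by (simp add: reps_def w_def)
  moreover have "x = cls w"
    using u(2) by (auto simp: cls_def w_def fun_eq_iff coset_zero)
  ultimately show "x \<in> cls ` reps" by blast
next
  fix x assume "x \<in> cls ` reps"
  then obtain w where w: "w \<in> reps" "x = cls w" by blast
  have "{i. cls w i \<noteq> P i} \<subseteq> {i. w i \<noteq> 0}"
    by (auto simp: cls_def coset_zero)
  then have "finite {i. cls w i \<noteq> P i}"
    using w(1) finite_subset by (auto simp: reps_def)
  moreover have "cls w i \<in> gr_component F i" for i
    using w(1) by (auto simp: cls_def gr_component_def reps_def)
  ultimately show "x \<in> carrier gr"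
    using w(2) by (simp add: gr_algebra_def)
qed

lemma cls_in_carrier: "w \<in> reps \<Longrightarrow> cls w \<in> carrier gr"
  by (simp add: carrier_gr)

lemma zero_in_reps: "(\<lambda>_. 0) \<in> reps"
  by (simp add: reps_def subspace_0[OF filt_subspace])

lemma add_in_reps:
  assumes "v \<in> reps" "w \<in> reps"
  shows "(\<lambda>i. v i + w i) \<in> reps"
proof -
  have "{i. v i + w i \<noteq> 0} \<subseteq> {i. v i \<noteq> 0} \<union> {i. w i \<noteq> 0}" by auto
  then have "finite {i. v i + w i \<noteq> 0}"
    using assms finite_subset by (fastforce simp: reps_def)
  then show ?thesis
    using assms subspace_add[OF filt_subspace] by (simp add: reps_def)
qed

lemma uminus_in_reps: "w \<in> reps \<Longrightarrow> (\<lambda>i. - w i) \<in> reps"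
  using subspace_neg[OF filt_subspace] by (simp add: reps_def)

lemma sum_in_reps: "(\<And>k. k \<in> K \<Longrightarrow> w k \<in> reps) \<Longrightarrow> (\<lambda>i. \<Sum>k\<in>K. w k i) \<in> reps"
  by (induction K rule: infinite_finite_induct) (auto simp: zero_in_reps add_in_reps)

lemma gr_add: "cls v \<oplus>\<^bsub>gr\<^esub> cls w = cls (\<lambda>i. v i + w i)"
  by (simp add: gr_algebra_def cls_def coset_add)

lemma gr_zero: "\<zero>\<^bsub>gr\<^esub> = cls (\<lambda>_. 0)"
  by (simp add: gr_algebra_def cls_def coset_zero fun_eq_iff)

lemma abelian_group_gr: "abelian_group gr"
proof (rule abelian_groupI)
  show "\<exists>y\<in>carrier gr. y \<oplus>\<^bsub>gr\<^esub> x = \<zero>\<^bsub>gr\<^esub>" if x: "x \<in> carrier gr" for x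
  proof -
    obtain w where w: "w \<in> reps" "x = cls w" using x by (auto simp: carrier_gr)
    then show ?thesis
      by (intro bexI[of _ "cls (\<lambda>i. - w i)"])
        (auto simp: gr_add gr_zero cls_in_carrier uminus_in_reps)
  qed
qed (auto simp: carrier_gr gr_add gr_zero zero_in_reps add_in_reps algebra_simps)

lemma gr_uminus:
  assumes "w \<in> reps"
  shows "\<ominus>\<^bsub>gr\<^esub> cls w = cls (\<lambda>i. - w i)"
  by (rule abelian_group.minus_equality[OF abelian_group_gr])
    (auto simp: gr_add gr_zero assms cls_in_carrier uminus_in_reps)

lemma gr_finsum:
  assumes "finite K" "\<And>k. k \<in> K \<Longrightarrow> w k \<in> reps"
  shows "(\<Oplus>\<^bsub>gr\<^esub>k\<in>K. cls (w k)) = cls (\<lambda>i. \<Sum>k\<in>K. w k i)"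
proof -
  interpret abelian_group gr by (rule abelian_group_gr)
  show ?thesis
    using assms
  proof (induction K rule: finite_induct)
    case empty
    then show ?case by (simp add: gr_zero)
  next
    case (insert k K)
    have "(\<Oplus>\<^bsub>gr\<^esub>k\<in>insert k K. cls (w k)) = cls (w k) \<oplus>\<^bsub>gr\<^esub> (\<Oplus>\<^bsub>gr\<^esub>k\<in>K. cls (w k))"
      using insert.hyps insert.prems by (intro finsum_insert) (auto simp: cls_in_carrier)
    then show ?case
      using insert by (simp add: gr_add)
  qed
qed

lemma mult_in_reps:
  assumes "v \<in> reps" "w \<in> reps"
  shows "(\<lambda>n. \<Sum>i\<le>n. v i * w (n - i)) \<in> reps"
proof -
  let ?V = "{i. v i \<noteq> 0}" and ?W = "{i. w i \<noteq> 0}"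
  have "{n. (\<Sum>i\<le>n. v i * w (n - i)) \<noteq> 0} \<subseteq> (\<lambda>(i, j). i + j) ` (?V \<times> ?W)"
  proof
    fix n assume "n \<in> {n. (\<Sum>i\<le>n. v i * w (n - i)) \<noteq> 0}"
    then obtain i where "i \<le> n" "v i * w (n - i) \<noteq> 0"
      by (metis (mono_tags, lifting) atMost_iff mem_Collect_eq sum.neutral)
    then show "n \<in> (\<lambda>(i, j). i + j) ` (?V \<times> ?W)"
      by (intro image_eqI[of _ _ "(i, n - i)"]) auto
  qed
  moreover have "finite (?V \<times> ?W)" using assms by (simp add: reps_def)
  ultimately have "finite {n. (\<Sum>i\<le>n. v i * w (n - i)) \<noteq> 0}"
    using finite_surj by blast
  moreover have "(\<Sum>i\<le>n. v i * w (n - i)) \<in> F n" for n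
  proof (intro subspace_sum[OF filt_subspace])
    fix i assume "i \<in> {..n}"
    then show "v i * w (n - i) \<in> F n"
      using filt_mult[of "v i" i "w (n - i)" "n - i"] assms by (simp add: reps_def)
  qed
  ultimately show ?thesis by (simp add: reps_def)
qed

lemma gr_mult:
  assumes "v \<in> reps" "w \<in> reps"
  shows "cls v \<otimes>\<^bsub>gr\<^esub> cls w = cls (\<lambda>n. \<Sum>i\<le>n. v i * w (n - i))"
proof
  fix n
  have "(cls v \<otimes>\<^bsub>gr\<^esub> cls w) n = (\<Sum>i\<le>n. gr_component_mult F i (n - i) (cls v i) (cls w (n - i)))"
    by (simp add: gr_algebra_def)
  also have "\<dots> = (\<Sum>i\<le>n. (v i * w (n - i)) +o P n)"
  proof (intro sum.cong refl)
    fix i assume "i \<in> {..n}"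
    then show "gr_component_mult F i (n - i) (cls v i) (cls w (n - i)) = (v i * w (n - i)) +o P n"
      using gr_component_mult_coset[of "v i" i "w (n - i)" "n - i"] assms
      by (simp add: cls_def reps_def)
  qed
  also have "\<dots> = (\<Sum>i\<le>n. v i * w (n - i)) +o P n"
    by (intro coset_sum) auto
  finally show "(cls v \<otimes>\<^bsub>gr\<^esub> cls w) n = cls (\<lambda>n. \<Sum>i\<le>n. v i * w (n - i)) n"
    by (simp add: cls_def)
qed

lemma gr_mult_closed: "x \<in> carrier gr \<Longrightarrow> y \<in> carrier gr \<Longrightarrow> x \<otimes>\<^bsub>gr\<^esub> y \<in> carrier gr"
  by (auto simp: carrier_gr gr_mult mult_in_reps)

text \<open>With an integer degree, \<open>n - deg (g ! j)\<close> can be inserted as it stands; in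
  negative degree the family is zero.\<close>

definition homog :: "int \<Rightarrow> 'a \<Rightarrow> nat \<Rightarrow> 'a" where
  "homog p u = (\<lambda>n. if int n = p then u else 0)"

text \<open>Right multiplication by the class of \<open>b\<close> in degree \<open>q\<close>,
  carried out on representatives.\<close>

definition shift_mult :: "nat \<Rightarrow> 'a \<Rightarrow> (nat \<Rightarrow> 'a) \<Rightarrow> nat \<Rightarrow> 'a" where
  "shift_mult q b w = (\<lambda>n. if q \<le> n then w (n - q) * b else 0)"

lemma homog_in_reps:
  assumes "u \<in> G p"
  shows "homog p u \<in> reps"
proof -
  have "finite {n. homog p u n \<noteq> 0}"
    by (rule finite_subset[of _ "{nat p}"]) (auto simp: homog_def split: if_splits)
  then show ?thesis
    using assms subspace_0[OF filt_subspace] G_of_nat by (auto simp: reps_def homog_def)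
qed

lemma gr_mult_homog:
  assumes "w \<in> reps" "b \<in> F q"
  shows "cls w \<otimes>\<^bsub>gr\<^esub> cls (homog (int q) b) = cls (shift_mult q b w)"
    and "shift_mult q b w \<in> reps"
proof -
  have b: "homog (int q) b \<in> reps"
    using homog_in_reps[of b "int q"] assms(2) by (simp add: G_of_nat)
  have "(\<lambda>n. \<Sum>i\<le>n. w i * homog (int q) b (n - i)) = shift_mult q b w"
  proof
    fix n
    have "(\<Sum>i\<le>n. w i * homog (int q) b (n - i)) = (\<Sum>i\<le>n. if i = n - q \<and> q \<le> n then w i * b else 0)"
      by (intro sum.cong) (auto simp: homog_def)
    also have "\<dots> = shift_mult q b w n"
      by (cases "q \<le> n") (auto simp: shift_mult_def)
    finally show "(\<Sum>i\<le>n. w i * homog (int q) b (n - i)) = shift_mult q b w n" .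
  qed
  then show "cls w \<otimes>\<^bsub>gr\<^esub> cls (homog (int q) b) = cls (shift_mult q b w)" "shift_mult q b w \<in> reps"
    using gr_mult[OF assms(1) b] mult_in_reps[OF assms(1) b] by simp_all
qed

lemma gr_homog_mult:
  assumes "w \<in> reps" "s \<in> F 0"
  shows "cls (homog 0 s) \<otimes>\<^bsub>gr\<^esub> cls w = cls (\<lambda>n. s * w n)"
    and "(\<lambda>n. s * w n) \<in> reps"
proof -
  have s: "homog 0 s \<in> reps"
    using homog_in_reps[of s 0] assms(2) by (simp add: G_def)
  have "(\<lambda>n. \<Sum>i\<le>n. homog 0 s i * w (n - i)) = (\<lambda>n. s * w n)"
  proof
    fix n
    have "(\<Sum>i\<le>n. homog 0 s i * w (n - i)) = (\<Sum>i\<le>n. if i = 0 then s * w n else 0)"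
      by (intro sum.cong) (auto simp: homog_def)
    then show "(\<Sum>i\<le>n. homog 0 s i * w (n - i)) = s * w n" by simp
  qed
  then show "cls (homog 0 s) \<otimes>\<^bsub>gr\<^esub> cls w = cls (\<lambda>n. s * w n)" "(\<lambda>n. s * w n) \<in> reps"
    using gr_mult[OF s assms(1)] mult_in_reps[OF s assms(1)] by simp_all
qed

lemma sign_in_F0: "(- 1) ^ m \<in> F 0"
proof (induction m)
  case 0
  have "scale 1 1 \<in> F 0" unfolding filt_zero by blast
  then show ?case by simp
next
  case (Suc m)
  then show ?case using subspace_neg[OF filt_subspace] by simp
qed

lemma gr_sign: "(\<ominus>\<^bsub>gr\<^esub> \<one>\<^bsub>gr\<^esub>) [^]\<^bsub>gr\<^esub> (m :: nat) = cls (homog 0 ((- 1) ^ m))"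
proof -
  have one: "\<one>\<^bsub>gr\<^esub> = cls (homog 0 1)"
    by (auto simp: gr_algebra_def cls_def homog_def fun_eq_iff coset_zero)
  have homog_uminus: "(\<lambda>i. - homog 0 x i) = homog 0 (- x)" for x
    by (auto simp: homog_def)
  have in_reps: "homog 0 x \<in> reps" if "x \<in> F 0" for x
    using homog_in_reps[of x 0] that by (simp add: G_def)
  show ?thesis
  proof (induction m)
    case 0
    then show ?case by (simp add: nat_pow_def one)
  next
    case (Suc m)
    have "(\<lambda>n. (- 1) ^ m * homog 0 (- 1) n) = homog 0 ((- 1) ^ Suc m)"
      by (auto simp: homog_def)
    moreover have "\<ominus>\<^bsub>gr\<^esub> \<one>\<^bsub>gr\<^esub> = cls (homog 0 (- 1))"
      using in_reps[of 1] sign_in_F0[of 0] by (simp add: one gr_uminus homog_uminus)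
    moreover have "homog 0 (- 1) \<in> reps"
      using in_reps[of "- 1"] sign_in_F0[of 1] by simp
    moreover have "(\<ominus>\<^bsub>gr\<^esub> \<one>\<^bsub>gr\<^esub>) [^]\<^bsub>gr\<^esub> Suc m = (\<ominus>\<^bsub>gr\<^esub> \<one>\<^bsub>gr\<^esub>) [^]\<^bsub>gr\<^esub> m \<otimes>\<^bsub>gr\<^esub> (\<ominus>\<^bsub>gr\<^esub> \<one>\<^bsub>gr\<^esub>)"
      by (simp add: nat_pow_def)
    ultimately show ?case
      using Suc gr_homog_mult[of "homog 0 (- 1)" "(- 1) ^ m"] sign_in_F0[of m] by simp
  qed
qed

lemma in_filt_degree: "u \<in> F (filt_degree F u)"
proof -
  have "\<exists>i. u \<in> F i" using filt_exhaustive by blast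
  then show ?thesis unfolding filt_degree_def by (rule LeastI_ex)
qed

lemma gr_symbol_eq: "gr_symbol F u = cls (homog (int (filt_degree F u)) u)"
  by (auto simp: gr_symbol_def cls_def homog_def coset_zero fun_eq_iff)

section \<open>The Koszul complex on representatives\<close>

text \<open>Through \<open>cls_eq_iff\<close> this turns identities between chains over the graded
  algebra into memberships in \<open>U\<close>, one for each degree.\<close>

lemma koszul_diff_cls:
  assumes T: "T \<in> wedge_basis (length g) (i - 1)"
    and w: "\<And>k. k \<in> {..<length g} - T \<Longrightarrow> \<phi> (insert k T) = cls (w (insert k T)) \<and> w (insert k T) \<in> reps"
  shows "koszul_diff gr (map (gr_symbol F) g) i \<phi> T = cls (\<lambda>n. \<Sum>k\<in>{..<length g} - T.
      (- 1) ^ card {j\<in>T. j < k} * shift_mult (filt_degree F (g ! k)) (g ! k) (w (insert k T)) n)"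
    and "(\<lambda>n. \<Sum>k\<in>{..<length g} - T.
      (- 1) ^ card {j\<in>T. j < k} * shift_mult (filt_degree F (g ! k)) (g ! k) (w (insert k T)) n) \<in> reps"
proof -
  let ?s = "\<lambda>k. shift_mult (filt_degree F (g ! k)) (g ! k) (w (insert k T))"
  let ?r = "\<lambda>k n. (- 1) ^ card {j\<in>T. j < k} * ?s k n"
  have s: "?s k \<in> reps" if "k \<in> {..<length g} - T" for k
    using w[OF that] in_filt_degree by (intro gr_mult_homog(2)) auto
  have r: "?r k \<in> reps" if "k \<in> {..<length g} - T" for k
    using gr_homog_mult(2)[OF s[OF that] sign_in_F0] .
  have summand: "(\<ominus>\<^bsub>gr\<^esub> \<one>\<^bsub>gr\<^esub>) [^]\<^bsub>gr\<^esub> card {j\<in>T. j < k} \<otimes>\<^bsub>gr\<^esub>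
      (\<phi> (insert k T) \<otimes>\<^bsub>gr\<^esub> map (gr_symbol F) g ! k) = cls (?r k)" if "k \<in> {..<length g} - T" for k
  proof -
    have "\<phi> (insert k T) \<otimes>\<^bsub>gr\<^esub> map (gr_symbol F) g ! k = cls (?s k)"
      using w[OF that] that in_filt_degree gr_mult_homog(1)[of "w (insert k T)" "g ! k" "filt_degree F (g ! k)"]
      by (simp add: gr_symbol_eq)
    then show ?thesis
      using gr_homog_mult(1)[OF s[OF that] sign_in_F0] by (simp add: gr_sign)
  qed
  interpret abelian_group gr by (rule abelian_group_gr)
  have "koszul_diff gr (map (gr_symbol F) g) i \<phi> T =
      (\<Oplus>\<^bsub>gr\<^esub>k\<in>{..<length g} - T. cls (?r k))"
    unfolding koszul_diff_def using T r summand by (auto intro!: finsum_cong' simp: cls_in_carrier)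
  also have "\<dots> = cls (\<lambda>n. \<Sum>k\<in>{..<length g} - T. ?r k n)"
    using r by (intro gr_finsum) auto
  finally show "koszul_diff gr (map (gr_symbol F) g) i \<phi> T = cls (\<lambda>n. \<Sum>k\<in>{..<length g} - T. ?r k n)" .
  show "(\<lambda>n. \<Sum>k\<in>{..<length g} - T. ?r k n) \<in> reps"
    using r by (intro sum_in_reps) auto
qed

lemma koszul_chains_group: "group (koszul_chains gr t i)"
  unfolding koszul_chains_def using abelian_group.a_group[OF abelian_group_gr] by simp

lemma koszul_chains_carrier: "carrier (koszul_chains gr t i) = (\<Pi>\<^sub>E S\<in>wedge_basis t i. carrier gr)"
  by (simp add: koszul_chains_def)

lemma koszul_chains_one: "\<one>\<^bsub>koszul_chains gr t i\<^esub> = (\<lambda>S\<in>wedge_basis t i. \<zero>\<^bsub>gr\<^esub>)"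
  by (simp add: koszul_chains_def)

lemma wedge_basis_insert:
  assumes "T \<in> wedge_basis t (i - 1)" "k \<in> {..<t} - T"
  shows "insert k T \<in> wedge_basis t i"
proof -
  have "T \<subseteq> {..<t}" "finite T"
    using assms(1) finite_subset[of T "{..<t}"] by (auto simp: wedge_basis_def)
  then show ?thesis using assms by (auto simp: wedge_basis_def)
qed

text \<open>The only coset in a trivial quotient is the set of boundaries itself. It contains the
  zero chain, so a cycle lies in its own coset, which is that set.\<close>

lemma koszul_boundary:
  assumes triv: "trivial_group (koszul_homology gr (map (gr_symbol F) g) i)"
    and \<phi>: "\<phi> \<in> carrier (koszul_chains gr (length g) i)"
    and cycle: "koszul_diff gr (map (gr_symbol F) g) i \<phi> = \<one>\<^bsub>koszul_chains gr (length g) (i - 1)\<^esub>"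
  obtains \<psi> where "\<psi> \<in> carrier (koszul_chains gr (length g) (i + 1))"
    "koszul_diff gr (map (gr_symbol F) g) (i + 1) \<psi> = \<phi>"
proof -
  let ?K = "koszul_chains gr (length g)" and ?d = "koszul_diff gr (map (gr_symbol F) g)"
  let ?H = "?d (i + 1) ` carrier (?K (i + 1))"
  let ?Z = "(?K i)\<lparr>carrier := kernel (?K i) (?K (i - 1)) (?d i)\<rparr>"
  interpret K: group "?K i" by (rule koszul_chains_group)
  have zero: "?d (i + 1) \<one>\<^bsub>?K (i + 1)\<^esub> = \<one>\<^bsub>?K i\<^esub>"
  proof
    fix T
    show "?d (i + 1) \<one>\<^bsub>?K (i + 1)\<^esub> T = \<one>\<^bsub>?K i\<^esub> T"
    proof (cases "T \<in> wedge_basis (length g) i")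
      case True
      then have T: "T \<in> wedge_basis (length g) (i + 1 - 1)" by simp
      have "\<one>\<^bsub>?K (i + 1)\<^esub> (insert k T) = cls (\<lambda>_. 0) \<and> (\<lambda>_. 0) \<in> reps" if "k \<in> {..<length g} - T" for k
        using wedge_basis_insert[OF T that] by (simp add: koszul_chains_one gr_zero zero_in_reps)
      from koszul_diff_cls(1)[OF T, of "\<one>\<^bsub>?K (i + 1)\<^esub>" "\<lambda>_ _. 0", OF this]
      show ?thesis using True by (simp add: koszul_chains_one gr_zero shift_mult_def cong: if_cong)
    next
      case False
      then show ?thesis by (simp add: koszul_diff_def koszul_chains_one)
    qed
  qed
  have "\<one>\<^bsub>?K i\<^esub> \<in> ?H"
    using zero monoid.one_closed[OF group.is_monoid[OF koszul_chains_group], of "length g" "i + 1"]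
    by (intro image_eqI[of _ _ "\<one>\<^bsub>?K (i + 1)\<^esub>"]) simp_all
  moreover have "\<one>\<^bsub>?K i\<^esub> \<otimes>\<^bsub>?Z\<^esub> \<phi> = \<phi>"
    using \<phi> by simp
  ultimately have "\<phi> \<in> ?H #>\<^bsub>?Z\<^esub> \<phi>"
    unfolding r_coset_def by force
  moreover have "?H #>\<^bsub>?Z\<^esub> \<phi> = ?H"
  proof -
    have "\<phi> \<in> carrier ?Z" using \<phi> cycle by (simp add: kernel_def)
    then have "?H #>\<^bsub>?Z\<^esub> \<phi> \<in> carrier (?Z Mod ?H)"
      unfolding carrier_FactGroup by blast
    moreover have "carrier (?Z Mod ?H) = {?H}"
      using triv by (simp add: trivial_group_def koszul_homology_def Let_def)
    ultimately show ?thesis by blast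
  qed
  ultimately have "\<phi> \<in> ?H" by simp
  then show ?thesis using that by auto
qed

section \<open>Commutativity of the graded algebra\<close>

text \<open>Commutativity of the polynomial ring passes to products of cosets and is pulled back
  along \<open>h\<close>. The closure hypotheses place both products where \<open>h\<close> is
  injective.\<close>

lemma CI_algebra_commute:
  fixes A :: "('k, 'b) module"
  assumes "CI_algebra A" "x \<in> carrier A" "y \<in> carrier A"
    "x \<otimes>\<^bsub>A\<^esub> y \<in> carrier A" "y \<otimes>\<^bsub>A\<^esub> x \<in> carrier A"
  shows "x \<otimes>\<^bsub>A\<^esub> y = y \<otimes>\<^bsub>A\<^esub> x"
proof -
  obtain n fs h where h: "h \<in> ring_iso A
      (quotient_algebra (polynomial_algebra n :: ('k, _) module) (genideal (polynomial_algebra n) (set fs)))"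
    using assms(1) unfolding CI_algebra_def algebra_iso_def by blast
  let ?R = "polynomial_algebra n :: ('k, _) module"
  let ?B = "quotient_algebra ?R (genideal ?R (set fs))"
  let ?m = "rcoset_mult ?R (genideal ?R (set fs))"
  have "?m X Y \<subseteq> ?m Y X" for X Y
  proof
    fix z assume "z \<in> ?m X Y"
    then obtain a b where ab: "a \<in> X" "b \<in> Y" "z \<in> genideal ?R (set fs) +>\<^bsub>?R\<^esub> (a \<otimes>\<^bsub>?R\<^esub> b)"
      unfolding rcoset_mult_def by blast
    have "a \<otimes>\<^bsub>?R\<^esub> b = b \<otimes>\<^bsub>?R\<^esub> a"
      by (simp add: polynomial_algebra_def mult.commute)
    then show "z \<in> ?m Y X"
      using ab unfolding rcoset_mult_def by auto
  qed
  then have "X \<otimes>\<^bsub>?B\<^esub> Y = Y \<otimes>\<^bsub>?B\<^esub> X" for X Y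
    by (simp add: quotient_algebra_def ring.defs FactRing_def subset_antisym)
  then have "h (x \<otimes>\<^bsub>A\<^esub> y) = h (y \<otimes>\<^bsub>A\<^esub> x)"
    using ring_iso_memE(2)[OF h] assms(2,3) by simp
  moreover have "inj_on h (carrier A)"
    using h by (simp add: ring_iso_def bij_betw_def)
  ultimately show ?thesis
    using assms(4,5) by (simp add: inj_on_def)
qed

text \<open>Commutativity for the classes of \<open>x\<close> and \<open>y\<close>, read off in
  degree \<open>m + n\<close>.\<close>

lemma commutator_lower:
  assumes CI: "CI_algebra gr" and x: "x \<in> G m" and y: "y \<in> G n"
  shows "x * y - y * x \<in> G (m + n - 1)"
proof (cases "m < 0 \<or> n < 0")
  case True
  then show ?thesis
    using x y subspace_0[OF subspace_G] by (auto simp: G_neg)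
next
  case False
  then obtain p q where [simp]: "m = int p" "n = int q"
    by (metis nonneg_int_cases not_le_imp_less)
  have reps: "homog m x \<in> reps" "homog n y \<in> reps"
    using x y by (simp_all add: homog_in_reps)
  have F: "x \<in> F p" "y \<in> F q" using x y by (simp_all add: G_of_nat)
  have "shift_mult q y (homog m x) = homog (m + n) (x * y)"
    "shift_mult p x (homog n y) = homog (m + n) (y * x)"
    by (auto simp: shift_mult_def homog_def fun_eq_iff)
  moreover have "cls (homog m x) \<otimes>\<^bsub>gr\<^esub> cls (homog n y) = cls (homog n y) \<otimes>\<^bsub>gr\<^esub> cls (homog m x)"
    using reps by (intro CI_algebra_commute[OF CI] gr_mult_closed) (auto simp: cls_in_carrier)
  ultimately have "cls (homog (m + n) (x * y)) = cls (homog (m + n) (y * x))"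
    using gr_mult_homog(1)[OF reps(1) F(2)] gr_mult_homog(1)[OF reps(2) F(1)] by simp
  then have "homog (m + n) (x * y) (p + q) - homog (m + n) (y * x) (p + q) \<in> P (p + q)"
    unfolding cls_eq_iff by blast
  then show ?thesis
    by (simp add: homog_def filt_pred_eq_G)
qed

section \<open>Koszul homology of the symbols in degrees one and zero\<close>

abbreviation deg :: "'a \<Rightarrow> int" where "deg u \<equiv> int (filt_degree F u)"

lemma in_G_deg: "u \<in> G (deg u)"
  by (simp add: G_of_nat in_filt_degree)

lemma wedge_basis_0: "wedge_basis t 0 = {{}}"
  using finite_subset[of _ "{..<t}"] by (auto simp: wedge_basis_def)

text \<open>The \<open>a j\<close> form a homogeneous one-cycle over the graded algebra; the
  coefficients \<open>c\<close> are the components, in the matching degrees, of a chain that bounds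
  it.\<close>

lemma koszul_symbols_exact:
  fixes g :: "'a list"
  defines "t \<equiv> length g"
  assumes triv: "trivial_group (koszul_homology gr (map (gr_symbol F) g) 1)"
    and a: "\<And>j. j < t \<Longrightarrow> a j \<in> G (n - deg (g ! j))"
    and cycle: "(\<Sum>j<t. a j * g ! j) \<in> G (n - 1)"
  shows "\<exists>c. (\<forall>i<t. c i i = 0) \<and> (\<forall>i<t. \<forall>j<t. c i j \<in> G (n - deg (g ! i) - deg (g ! j))) \<and>
    (\<forall>i<t. \<forall>j<t. c i j + c j i = 0) \<and>
    (\<forall>i<t. a i - (\<Sum>j<t. c i j * g ! j) \<in> G (n - deg (g ! i) - 1))"
proof -
  let ?d = "koszul_diff gr (map (gr_symbol F) g)" and ?K = "koszul_chains gr (length g)"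
  \<comment> \<open>With \<open>a j\<close> placed in degree \<open>n - deg (g ! j)\<close>, the
    boundary is concentrated in degree \<open>n\<close>, where \<open>cycle\<close> makes it
    vanish.\<close>
  define w where "w S = homog (n - deg (g ! the_elem S)) (a (the_elem S))" for S
  define \<phi> where "\<phi> = (\<lambda>S\<in>wedge_basis t 1. cls (w S))"
  have basis1: "S \<in> wedge_basis t 1 \<longleftrightarrow> (\<exists>k<t. S = {k})" for S
    by (auto simp: wedge_basis_def card_1_singleton_iff)
  have w: "w {k} \<in> reps" if "k < t" for k
    using a[OF that] by (simp add: w_def homog_in_reps)
  have \<phi>: "\<phi> \<in> carrier (?K 1)"
    using w by (auto simp: koszul_chains_carrier \<phi>_def t_def[symmetric] basis1 cls_in_carrier)
  have "?d 1 \<phi> {} = \<zero>\<^bsub>gr\<^esub>"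
  proof -
    have "?d 1 \<phi> {} = cls (\<lambda>m. \<Sum>k<t. shift_mult (filt_degree F (g ! k)) (g ! k) (w {k}) m)"
      using koszul_diff_cls(1)[of "{}" g 1 \<phi> w] w
      by (simp add: wedge_basis_0 t_def[symmetric] \<phi>_def basis1)
    moreover have "shift_mult (filt_degree F (g ! k)) (g ! k) (w {k}) m =
        (if int m = n then a k * g ! k else 0)" if "k < t" for k m
      using a[OF that] by (auto simp: shift_mult_def w_def homog_def G_neg)
    then have "(\<Sum>k<t. shift_mult (filt_degree F (g ! k)) (g ! k) (w {k}) m) =
        (if int m = n then \<Sum>k<t. a k * g ! k else 0)" for m
      by simp
    ultimately have "?d 1 \<phi> {} = cls (\<lambda>m. if int m = n then (\<Sum>k<t. a k * g ! k) else 0)"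
      by simp
    also have "\<dots> = cls (\<lambda>_. 0)"
      using cycle by (auto simp: cls_eq_iff filt_pred_eq_G subspace_0[OF subspace_G])
    finally show ?thesis by (simp add: gr_zero)
  qed
  then have "?d 1 \<phi> = \<one>\<^bsub>?K (1 - 1)\<^esub>"
    by (auto simp: koszul_chains_one wedge_basis_0 koszul_diff_def fun_eq_iff)
  then obtain \<psi> where \<psi>: "\<psi> \<in> carrier (?K (1 + 1))" "?d (1 + 1) \<psi> = \<phi>"
    by (rule koszul_boundary[OF triv \<phi>])
  have "\<exists>W. W \<in> reps \<and> (S \<in> wedge_basis t 2 \<longrightarrow> \<psi> S = cls W)" for S
    using \<psi>(1) zero_in_reps
    by (cases "S \<in> wedge_basis t 2") (auto simp: koszul_chains_carrier t_def carrier_gr PiE_def Pi_def)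
  then obtain W where W: "\<And>S. W S \<in> reps" "\<And>S. S \<in> wedge_basis t 2 \<Longrightarrow> \<psi> S = cls (W S)"
    by metis
  \<comment> \<open>The basis vector of \<open>{i, j}\<close> contributes to that of
    \<open>{i}\<close> with sign -1 exactly if \<open>i < j\<close>, as the removed index
    \<open>j\<close> then stands second. Since \<open>W {i, j}\<close> is symmetric, the sign gives
    antisymmetry. The value 0 covers negative degrees, which \<open>nat\<close> would
    truncate.\<close>
  define c where "c i j = (if i = j \<or> n < deg (g ! i) + deg (g ! j) then 0 else
      (if i < j then -1 else 1) * W {i, j} (nat (n - deg (g ! i) - deg (g ! j))))" for i j
  have 1: "c i i = 0" for i by (simp add: c_def)
  have 2: "c i j \<in> G (n - deg (g ! i) - deg (g ! j))" for i j
  proof (cases "i = j \<or> n < deg (g ! i) + deg (g ! j)")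
    case True
    then show ?thesis by (simp add: c_def subspace_0[OF subspace_G])
  next
    case False
    have "W {i, j} (nat (n - deg (g ! i) - deg (g ! j))) \<in> G (n - deg (g ! i) - deg (g ! j))"
      using W(1)[of "{i, j}"] False by (simp add: G_def reps_def)
    then show ?thesis
      using False subspace_neg[OF subspace_G] by (simp add: c_def)
  qed
  have 3: "c i j + c j i = 0" for i j
    by (auto simp: c_def insert_commute add.commute algebra_simps)
  have 4: "a i - (\<Sum>j<t. c i j * g ! j) \<in> G (n - deg (g ! i) - 1)" if "i < t" for i
  proof (cases "n < deg (g ! i)")
    case True
    then show ?thesis
      using a[OF that] by (simp add: c_def G_neg)
  next
    case False
    define m where "m = nat (n - deg (g ! i))"
    have m: "int m = n - deg (g ! i)" using False by (simp add: m_def)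
    have T: "{i} \<in> wedge_basis (length g) (1 + 1 - 1)" using that by (simp add: basis1 t_def[symmetric])
    have \<psi>W: "\<psi> (insert k {i}) = cls (W (insert k {i})) \<and> W (insert k {i}) \<in> reps"
      if "k \<in> {..<length g} - {i}" for k
      using W wedge_basis_insert[OF T that] by (simp add: t_def)
    have "\<phi> {i} = cls (\<lambda>n. \<Sum>k\<in>{..<length g} - {i}.
      (- 1) ^ card {j\<in>{i}. j < k} * shift_mult (filt_degree F (g ! k)) (g ! k) (W (insert k {i})) n)"
      using koszul_diff_cls(1)[OF T, of \<psi> W] \<psi>W \<psi>(2) by simp
    moreover have "\<phi> {i} = cls (w {i})" using that by (simp add: \<phi>_def basis1)
    ultimately have "cls (w {i}) = cls (\<lambda>n. \<Sum>k\<in>{..<length g} - {i}.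
      (- 1) ^ card {j\<in>{i}. j < k} * shift_mult (filt_degree F (g ! k)) (g ! k) (W (insert k {i})) n)"
      by simp
    then have "w {i} m - (\<Sum>k\<in>{..<t} - {i}.
      (- 1) ^ card {j\<in>{i}. j < k} * shift_mult (filt_degree F (g ! k)) (g ! k) (W (insert k {i})) m) \<in> P m"
      unfolding t_def cls_eq_iff by (rule spec)
    moreover have "w {i} m = a i"
      using m by (simp add: w_def homog_def)
    moreover have "(- 1) ^ card {j\<in>{i}. j < k} * shift_mult (filt_degree F (g ! k)) (g ! k) (W (insert k {i})) m =
        c i k * g ! k" if "k \<noteq> i" for k
    proof -
      have "{j\<in>{i}. j < k} = (if i < k then {i} else {})" by auto
      moreover have "filt_degree F (g ! k) \<le> m \<longleftrightarrow> \<not> n < deg (g ! i) + deg (g ! k)"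
        using m by linarith
      moreover have "m - filt_degree F (g ! k) = nat (n - deg (g ! i) - deg (g ! k))"
        using m by linarith
      ultimately show ?thesis
        using that by (auto simp: c_def shift_mult_def insert_commute)
    qed
    ultimately have "a i - (\<Sum>k\<in>{..<t} - {i}. c i k * g ! k) \<in> P m"
      by simp
    moreover have "(\<Sum>k<t. c i k * g ! k) = (\<Sum>k\<in>{..<t} - {i}. c i k * g ! k)"
      using that by (simp add: sum.remove[of "{..<t}" i] c_def)
    ultimately show ?thesis
      using m by (simp add: filt_pred_eq_G)
  qed
  show ?thesis
    using 1 2 3 4 by (intro exI[of _ c]) simp
qed

text \<open>Multiplying such a representation of \<open>1\<close> by an arbitrary element would make
  every zero-chain a boundary. Under the hypothesis on \<open>b\<close> only those
  \<open>g ! j\<close> of degree zero contribute, so the identity holds in the graded algebra as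
  well.\<close>

lemma koszul_symbols_proper:
  fixes g :: "'a list"
  defines "t \<equiv> length g"
  assumes nontriv: "\<not> trivial_group (koszul_homology gr (map (gr_symbol F) g) 0)"
    and b: "\<And>j. j < t \<Longrightarrow> b j \<in> G (- deg (g ! j))"
  shows "(\<Sum>j<t. b j * g ! j) \<noteq> 1"
proof
  assume unit: "(\<Sum>j<t. b j * g ! j) = 1"
  let ?d = "koszul_diff gr (map (gr_symbol F) g)" and ?K = "koszul_chains gr (length g)"
  have basis1: "S \<in> wedge_basis t 1 \<longleftrightarrow> (\<exists>k<t. S = {k})" for S
    by (auto simp: wedge_basis_def card_1_singleton_iff)
  interpret K: group "?K 0" by (rule koszul_chains_group)
  have image: "?d (0 + 1) ` carrier (?K (0 + 1)) = carrier (?K 0)"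
  proof (intro equalityI subsetI)
    fix \<phi> assume "\<phi> \<in> ?d (0 + 1) ` carrier (?K (0 + 1))"
    then obtain \<psi> where \<psi>: "\<psi> \<in> carrier (?K 1)" "\<phi> = ?d 1 \<psi>" by auto
    have "\<exists>W. W \<in> reps \<and> (S \<in> wedge_basis t 1 \<longrightarrow> \<psi> S = cls W)" for S
      using \<psi>(1) zero_in_reps
      by (cases "S \<in> wedge_basis t 1") (auto simp: koszul_chains_carrier t_def carrier_gr PiE_def Pi_def)
    then obtain W where W: "\<And>S. W S \<in> reps" "\<And>S. S \<in> wedge_basis t 1 \<Longrightarrow> \<psi> S = cls (W S)"
      by metis
    have "?d 1 \<psi> {} \<in> carrier gr"
      using koszul_diff_cls[of "{}" g 1 \<psi> W] W
      by (simp add: wedge_basis_0 t_def[symmetric] basis1 cls_in_carrier)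
    then show "\<phi> \<in> carrier (?K 0)"
      unfolding \<psi>(2) koszul_chains_carrier wedge_basis_0
      by (auto simp: koszul_diff_def wedge_basis_0 PiE_def)
  next
    fix \<phi> assume \<phi>: "\<phi> \<in> carrier (?K 0)"
    then obtain w where w: "w \<in> reps" "\<phi> {} = cls w"
      by (auto simp: koszul_chains_carrier wedge_basis_0 PiE_def Pi_def carrier_gr)
    \<comment> \<open>Read off from \<open>w = (\<Sum>k<t. w * b k * g ! k)\<close>: the preimage
      has the entry \<open>w * b k\<close> at \<open>{k}\<close>.\<close>
    define v where "v S = (\<lambda>n. w n * b (the_elem S))" for S
    have v: "v {k} \<in> reps" if "k < t" for k
    proof -
      have "b k \<in> F 0" using b[OF that] G_mono[of "- deg (g ! k)" 0] by (auto simp: G_def split: if_splits)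
      then have "shift_mult 0 (b k) w \<in> reps"
        using gr_mult_homog(2)[OF w(1), of "b k" 0] by simp
      then show ?thesis by (simp add: shift_mult_def v_def)
    qed
    define \<psi> where "\<psi> = (\<lambda>S\<in>wedge_basis t 1. cls (v S))"
    have \<psi>: "\<psi> \<in> carrier (?K 1)"
      using v by (auto simp: koszul_chains_carrier \<psi>_def t_def[symmetric] basis1 cls_in_carrier)
    have "?d 1 \<psi> {} = cls (\<lambda>m. \<Sum>k<t. shift_mult (filt_degree F (g ! k)) (g ! k) (v {k}) m)"
      using koszul_diff_cls(1)[of "{}" g 1 \<psi> v] v
      by (simp add: wedge_basis_0 t_def[symmetric] \<psi>_def basis1)
    also have "\<dots> = cls (\<lambda>m. \<Sum>k<t. w m * (b k * g ! k))"
    proof -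
      have "shift_mult (filt_degree F (g ! k)) (g ! k) (v {k}) m = w m * (b k * g ! k)" if "k < t" for k m
        using b[OF that] by (cases "filt_degree F (g ! k) = 0") (auto simp: shift_mult_def v_def G_neg mult.assoc)
      then show ?thesis by simp
    qed
    also have "\<dots> = \<phi> {}"
      using unit by (simp add: sum_distrib_left[symmetric] w(2))
    finally have "?d 1 \<psi> {} = \<phi> {}" .
    then have "?d 1 \<psi> = \<phi>"
      using \<phi> by (auto simp: koszul_diff_def wedge_basis_0 koszul_chains_carrier PiE_def extensional_def fun_eq_iff)
    then show "\<phi> \<in> ?d (0 + 1) ` carrier (?K (0 + 1))"
      using \<psi> by auto
  qed
  \<comment> \<open>No set has cardinality -1, so every zero-chain is a cycle.\<close>
  have "wedge_basis t (- 1) = {}" by (auto simp: wedge_basis_def)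
  then have ker: "kernel (?K 0) (?K (0 - 1)) (?d 0) = carrier (?K 0)"
    by (auto simp: kernel_def koszul_chains_one koszul_diff_def t_def)
  have "koszul_homology gr (map (gr_symbol F) g) 0 = ?K 0 Mod carrier (?K 0)"
    unfolding koszul_homology_def Let_def length_map ker image by simp
  moreover have "trivial_group (?K 0 Mod carrier (?K 0))"
  proof -
    have "group (?K 0 Mod carrier (?K 0))"
      using normal.factorgroup_is_group[OF K.normal_self] .
    moreover have "carrier (?K 0 Mod carrier (?K 0)) = {carrier (?K 0)}"
      unfolding carrier_FactGroup using K.coset_join2[OF _ K.subgroup_self] K.one_closed by blast
    ultimately show ?thesis by (simp add: trivial_group_def)
  qed
  ultimately show False using nontriv by simp
qed

end

section \<open>Positivity of the degrees and conclusion\<close>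

theorem theorem1:
  fixes scale :: "'k::{alg_closed_field, field_char_0} \<Rightarrow> 'a::ring_1 \<Rightarrow> 'a"
    and F :: "nat \<Rightarrow> 'a set"
    and g :: "'a list"
  assumes "special_filtered_algebra scale F"
    and "\<forall>x\<in>set g. \<forall>y\<in>set g. x * y = y * x"
    and "complete_intersection (gr_algebra scale F) (map (gr_symbol F) g)"
  shows "free_as_left_module (assoc_algebra.generated_subalgebra scale (set g)) \<and>
         free_as_right_module (assoc_algebra.generated_subalgebra scale (set g))"
proof -
  interpret special_filtered_algebra scale F by (rule assms(1))
  let ?t = "length g" and ?d = "\<lambda>j. deg (g ! j)"
  have H1: "trivial_group (koszul_homology gr (map (gr_symbol F) g) 1)"
    and H0: "\<not> trivial_group (koszul_homology gr (map (gr_symbol F) g) 0)"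
    using assms(3) by (simp_all add: complete_intersection_def)
  \<comment> \<open>An element of degree zero is a scalar. The degree of \<open>0\<close> is zero
    too, so a vanishing \<open>g ! j\<close> must be excluded along with the nonzero
    scalars.\<close>
  have pos: "0 < ?d j" if "j < ?t" for j
  proof (rule ccontr)
    assume "\<not> 0 < ?d j"
    then have d0: "?d j = 0" by simp
    obtain k where k: "g ! j = scale k 1"
      using in_filt_degree[of "g ! j"] d0 by (auto simp: filt_zero)
    have one: "1 \<in> G 0"
      using sign_in_F0[of 0] by (simp add: G_def)
    show False
    proof (cases "k = 0")
      case True
      \<comment> \<open>If \<open>g ! j = 0\<close>, the basis vector at \<open>j\<close> is a cycle
        in degree 0. As nothing lies below degree 0, a chain bounding it gives
        \<open>1 = (\<Sum>l<?t. c j l * g ! l)\<close> exactly.\<close>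
      have "(\<Sum>i<?t. (if i = j then 1 else 0) * g ! i) = 0"
        using k True by (intro sum.neutral) auto
      then have cycle: "(\<Sum>i<?t. (if i = j then 1 else 0) * g ! i) \<in> G (0 - 1)"
        by (simp only: subspace_0[OF subspace_G])
      have "(if i = j then 1 else 0) \<in> G (0 - ?d i)" for i
        using one d0 subspace_0[OF subspace_G] by simp
      then obtain c where c: "\<forall>i<?t. \<forall>l<?t. c i l \<in> G (0 - ?d i - ?d l)"
        "\<forall>i<?t. (if i = j then 1 else 0) - (\<Sum>l<?t. c i l * g ! l) \<in> G (0 - ?d i - 1)"
        using koszul_symbols_exact[OF H1 _ cycle] by blast
      have "1 - (\<Sum>l<?t. c j l * g ! l) = 0"
        using c(2) that d0 G_neg[of "-1"] by auto
      moreover have "c j l \<in> G (- ?d l)" if "l < ?t" for l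
        using c(1) \<open>j < ?t\<close> that d0 by auto
      ultimately show False
        using koszul_symbols_proper[OF H0, of "c j"] by simp
    next
      case False
      \<comment> \<open>A nonzero scalar is invertible, and its inverse gives the forbidden
        representation of \<open>1\<close>.\<close>
      let ?b = "\<lambda>i. if i = j then scale (inverse k) 1 else 0"
      have "(\<Sum>i<?t. ?b i * g ! i) = (\<Sum>i<?t. if i = j then scale (inverse k) 1 * g ! j else 0)"
        by (intro sum.cong) auto
      also have "\<dots> = 1"
        using that k False by (simp add: mult_scale_one)
      finally have "(\<Sum>i<?t. ?b i * g ! i) = 1" .
      moreover have "?b i \<in> G (- ?d i)" for i
        using d0 subspace_0[OF subspace_G] subspace_scale[OF subspace_G one] by simp
      ultimately show False
        using koszul_symbols_proper[OF H0, of ?b] by blast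
    qed
  qed
  show ?thesis
    using free_over_generated_subalgebra[OF commutator_lower[OF gr_CI] assms(2), of ?d]
      in_G_deg pos koszul_symbols_exact[OF H1] by blast
qed

end
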